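(* Let $G=(V,E,\mu,w)$ be a weighted graph with $n$ vertices and $c$ connected components, and let $\beta=|E|-|V|+c$. Then for every $k\in\{1,\dots,n\}$, $$\lambda_k(\Delta_1)\le h_k(G),$$ and, whenever $k-\beta\ge1$, $$h_{k-\beta}(G)\le\lambda_k(\Delta_1).$$
   Context: A weighted graph is a quadruple $G=(V,E,\mu,w)$ with finite vertex set $V=\{1,\dots,n\}$, edge set $E\subseteq\{\{u,v\}:u\neq v\text{ in }V\}$, vertex weight $\mu:V\to(0,\infty)$ and edge weight $w:E\to(0,\infty)$; write $\mu_v=\mu(v)$, $w_{uv}=w(\{u,v\})$. For nonempty $A\subseteq V$, $\partial A=\{\{u,v\}\in E:u\in A,\ v\notin A\}$ and $\phi(A)=\dfrac{\sum_{\{u,v\}\in\partial A}w_{uv}}{\sum_{v\in A}\mu_v}$. The Cheeger $k$-constant is $h_k(G)=\min\max_{1\le i\le k}\phi(A_i)$, the minimum being over all $k$-tuples $(A_1,\dots,A_k)$ of pairwise disjoint nonempty subsets of $V$ ($1\le k\le n$). The $k$-th min-max eigenvalue of the graph $1$-Laplacian is $$\lambda_k(\Delta_1)=\inf_{S}\ \max_{x\in S}\frac{\sum_{\{u,v\}\in E}w_{uv}|x_u-x_v|}{\sum_{v\in V}\mu_v|x_v|},$$ the infimum over all nonempty compact $S\subset\mathbb R^n\setminus\{0\}$ with $S=-S$ and $\gamma(S)\ge k$, where $\gamma(S)=\min\{m\in\mathbb Z^+:\text{there is an odd continuous map }S\to\mathbb R^m\setminus\{0\}\}$ is the Krasnoselskii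 genus. *)

theory Defs
  imports "HOL-Analysis.Analysis"
begin

text \<open>
  The vertex set of a graph is the whole of a finite type \<open>'n\<close>, so that \<open>n = CARD('n)\<close> and
  \<open>\<real>\<^sup>n\<close> is \<open>real ^ 'n\<close>. Edges are two-element sets of vertices; the edge weight \<open>w\<close> is a total
  function that is only ever evaluated on edges.
\<close>

definition weighted_graph :: "'n::finite set set \<Rightarrow> ('n \<Rightarrow> real) \<Rightarrow> ('n set \<Rightarrow> real) \<Rightarrow> bool" where
  "weighted_graph E \<mu> w \<longleftrightarrow>
     E \<subseteq> {{u, v} | u v. u \<noteq> v} \<and> (\<forall>v. \<mu> v > 0) \<and> (\<forall>e\<in>E. w e > 0)"

definition graph_components :: "'n::finite set set \<Rightarrow> 'n set set" where
  "graph_components E = UNIV // {(u, v). {u, v} \<in> E}\<^sup>*"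

definition cycle_rank :: "'n::finite set set \<Rightarrow> int" where
  "cycle_rank E = int (card E) - int CARD('n) + int (card (graph_components E))"

definition edge_boundary :: "'n::finite set set \<Rightarrow> 'n set \<Rightarrow> 'n set set" where
  "edge_boundary E A = {{u, v} | u v. {u, v} \<in> E \<and> u \<in> A \<and> v \<notin> A}"

definition expansion ::
    "'n::finite set set \<Rightarrow> ('n \<Rightarrow> real) \<Rightarrow> ('n set \<Rightarrow> real) \<Rightarrow> 'n set \<Rightarrow> real" where
  "expansion E \<mu> w A = (\<Sum>e\<in>edge_boundary E A. w e) / (\<Sum>v\<in>A. \<mu> v)"

definition disjoint_tuples :: "nat \<Rightarrow> (nat \<Rightarrow> 'n::finite set) set" where
  "disjoint_tuples k =
     {A \<in> {1..k} \<rightarrow>\<^sub>E {B. B \<noteq> {}}. disjoint_family_on A {1..k}}"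

definition cheeger ::
    "'n::finite set set \<Rightarrow> ('n \<Rightarrow> real) \<Rightarrow> ('n set \<Rightarrow> real) \<Rightarrow> nat \<Rightarrow> real" where
  "cheeger E \<mu> w k = (MIN A\<in>disjoint_tuples k. MAX i\<in>{1..k}. expansion E \<mu> w (A i))"

lemma finite_disjoint_tuples: "finite (disjoint_tuples k :: (nat \<Rightarrow> 'n::finite set) set)"
proof -
  have "finite ({1..k} \<rightarrow>\<^sub>E {B :: 'n set. B \<noteq> {}})"
    by (intro finite_PiE) auto
  then show ?thesis
    unfolding disjoint_tuples_def by (rule rev_finite_subset) auto
qed

lemma disjoint_tuples_nonempty:
  assumes "k \<le> CARD('n::finite)"
  shows "(disjoint_tuples k :: (nat \<Rightarrow> 'n set) set) \<noteq> {}"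
proof -
  have "card {1..k} \<le> card (UNIV :: 'n set)"
    using assms by simp
  then obtain f :: "nat \<Rightarrow> 'n" where f: "inj_on f {1..k}"
    using card_le_inj[of "{1..k}" "UNIV :: 'n set"] by auto
  have "restrict (\<lambda>i. {f i}) {1..k} \<in> disjoint_tuples k"
    using f by (auto simp: disjoint_tuples_def disjoint_family_on_def inj_on_eq_iff)
  then show ?thesis
    by blast
qed

text \<open>The value \<open>\<bar>x\<^sub>u - x\<^sub>v\<bar>\<close> at the unordered pair \<open>{u, v}\<close>.\<close>

definition edge_diff :: "real ^ 'n \<Rightarrow> 'n::finite set \<Rightarrow> real" where
  "edge_diff x e = (THE d. \<exists>u v. e = {u, v} \<and> d = \<bar>x $ u - x $ v\<bar>)"

lemma edge_diff_insert [simp]: "edge_diff x {u, v} = \<bar>x $ u - x $ v\<bar>"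
  unfolding edge_diff_def
  by (rule the_equality) (auto simp: doubleton_eq_iff abs_minus_commute)

definition rayleigh ::
    "'n::finite set set \<Rightarrow> ('n \<Rightarrow> real) \<Rightarrow> ('n set \<Rightarrow> real) \<Rightarrow> real ^ 'n \<Rightarrow> real" where
  "rayleigh E \<mu> w x = (\<Sum>e\<in>E. w e * edge_diff x e) / (\<Sum>v\<in>UNIV. \<mu> v * \<bar>x $ v\<bar>)"

text \<open>
  \<open>Euclidean_space m\<close> is the topology of \<open>\<real>\<^sup>m\<close> realised on the functions \<open>nat \<Rightarrow> real\<close> that vanish
  from \<open>m\<close> on. Note that the empty set has genus \<open>1\<close>, so nonemptiness is required separately below.
\<close>

definition odd_map_into :: "'a::euclidean_space set \<Rightarrow> nat \<Rightarrow> ('a \<Rightarrow> nat \<Rightarrow> real) \<Rightarrow> bool" where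
  "odd_map_into S m f \<longleftrightarrow>
     continuous_map (top_of_set S) (Euclidean_space m) f \<and>
     (\<forall>x\<in>S. f (- x) = (\<lambda>i. - f x i)) \<and> (\<forall>x\<in>S. f x \<noteq> (\<lambda>i. 0))"

definition genus :: "'a::euclidean_space set \<Rightarrow> nat" where
  "genus S = (LEAST m. m \<ge> 1 \<and> (\<exists>f. odd_map_into S m f))"

definition genus_sets :: "nat \<Rightarrow> 'a::euclidean_space set set" where
  "genus_sets k = {S. S \<noteq> {} \<and> compact S \<and> 0 \<notin> S \<and> uminus ` S = S \<and> k \<le> genus S}"

text \<open>
  The supremum over \<open>S\<close> is a maximum by \<open>rayleigh_max_attained\<close> below. The infimum is over a set
  bounded below by \<open>0\<close>, and nonempty for \<open>k \<le> n\<close> since the unit sphere has genus \<open>n\<close> by the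
  Borsuk-Ulam theorem.
\<close>

definition minmax_eigenvalue ::
    "'n::finite set set \<Rightarrow> ('n \<Rightarrow> real) \<Rightarrow> ('n set \<Rightarrow> real) \<Rightarrow> nat \<Rightarrow> real" where
  "minmax_eigenvalue E \<mu> w k = (INF S\<in>genus_sets k. SUP x\<in>S. rayleigh E \<mu> w x)"

lemma rayleigh_max_attained:
  assumes G: "weighted_graph E \<mu> w" and S: "S \<in> genus_sets k"
  shows "\<exists>x\<in>S. rayleigh E \<mu> w x = (SUP y\<in>S. rayleigh E \<mu> w y) \<and>
               (\<forall>y\<in>S. rayleigh E \<mu> w y \<le> rayleigh E \<mu> w x)"
proof -
  have den: "(\<Sum>v\<in>UNIV. \<mu> v * \<bar>x $ v\<bar>) \<noteq> 0" if "x \<in> S" for x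
  proof -
    have "x \<noteq> 0"
      using S that by (auto simp: genus_sets_def)
    then obtain v where "x $ v \<noteq> 0"
      by (auto simp: vec_eq_iff)
    then have "(\<Sum>v\<in>UNIV. \<mu> v * \<bar>x $ v\<bar>) > 0"
      using G by (intro sum_pos2[of _ v]) (auto simp: weighted_graph_def less_imp_le)
    then show ?thesis
      by simp
  qed
  have num: "continuous_on S (\<lambda>x. edge_diff x e)" if eE: "e \<in> E" for e
  proof -
    obtain u v where e: "e = {u, v}"
      using G eE unfolding weighted_graph_def by blast
    show ?thesis
      unfolding e edge_diff_insert by (intro continuous_intros)
  qed
  have "continuous_on S (rayleigh E \<mu> w)"
    unfolding rayleigh_def using den by (intro continuous_intros num) auto
  then obtain x where x: "x \<in> S" "\<forall>y\<in>S. rayleigh E \<mu> w y \<le> rayleigh E \<mu> w x"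
    using S continuous_attains_sup[of S "rayleigh E \<mu> w"] by (auto simp: genus_sets_def)
  then have "(SUP y\<in>S. rayleigh E \<mu> w y) = rayleigh E \<mu> w x"
    by (intro cSup_eq_maximum) auto
  with x show ?thesis
    by metis
qed

end

theory Submission
  imports Defs "HOL-Homology.Invariance_of_Domain"
begin

text \<open>
  Write \<open>variation x\<close> and \<open>mass x\<close> for the numerator and denominator of the Rayleigh quotient.

  \<^bold>\<open>Upper bound.\<close> Let \<open>A\<^sub>1, \<dots>, A\<^sub>k\<close> be disjoint and attain the Cheeger constant. On the span of
  their indicator vectors the mass is additive while the variation is subadditive, so the Rayleigh
  quotient of \<open>\<Sum>t\<^sub>i 1\<^sub>A\<^sub>i\<close> is at most a weighted mean of the expansions of the \<open>A\<^sub>i\<close>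
  (\<open>rayleigh_combination_le\<close>). The unit sphere of coefficients is mapped by an odd continuous map
  onto a compact symmetric set of such vectors. That this set has genus at least \<open>k\<close> is the
  Borsuk-Ulam theorem.

  \<^bold>\<open>Borsuk-Ulam.\<close> It is deduced from the fact that an odd self-map of a sphere has odd Brouwer
  degree (\<open>odd_sdeg\<close>), by induction on the dimension. The theorem
  \<open>Borsuk_odd_mapping_degree_step\<close> compares, modulo 2, the degree of an odd map that preserves the
  equator with the degree of its restriction. An arbitrary odd map is brought into that form in two
  moves: an odd polynomial approximation is smooth, hence its restriction to the equator omits a
  point \<open>p\<close> and, being odd, its antipode; damping the component along \<open>p\<close> by the height over the
  equator then gives a homotopic odd map that takes the equator into the hyperplane orthogonal to
  \<open>p\<close>, and a reflection moves that hyperplane to the equatorial one.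

  \<^bold>\<open>Lower bound.\<close> Put \<open>m = k - \<beta>\<close> and \<open>h = h\<^sub>m(G)\<close>, and call a connected vertex set bad if its
  expansion is below \<open>h\<close>. No \<open>m\<close> bad sets are pairwise disjoint. In a forest, a family of connected
  sets can be pierced by as many vertices as it has disjoint members (\<open>packing_piercing\<close>), and
  \<open>\<beta>\<close> vertices suffice to turn \<open>G\<close> into a forest (\<open>card_many_earlier_le_cycle_rank\<close>).
  Therefore some set \<open>Q\<close> of at most \<open>(m - 1) + \<beta> = k - 1\<close> vertices meets every bad set
  (\<open>piercing_set\<close>). The restriction \<open>x \<mapsto> x|\<^sub>Q\<close> is an odd map into \<open>\<real>\<^sup>k\<^sup>-\<^sup>1\<close>, so it vanishes somewhere
  on any set \<open>S\<close> of genus at least \<open>k\<close>. At such an \<open>x\<close> all sets \<open>{x > t}\<close> and \<open>{x < -t}\<close> with \<open>t \<ge> 0\<close> avoid \<open>Q\<close>; as their connected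
  pieces are not bad, the co-area decomposition of the variation (\<open>layer_cake\<close>) gives Rayleigh
  quotient at least \<open>h\<close>.
\<close>

section \<open>Self-maps of Euclidean spheres and their degree\<close>

definition nsphere_set :: "nat \<Rightarrow> (nat \<Rightarrow> real) set" where
  "nsphere_set d = {x. (\<Sum>i\<le>d. (x i)\<^sup>2) = 1 \<and> (\<forall>i>d. x i = 0)}"

lemma nsphere_eq_top_of_set: "nsphere d = top_of_set (nsphere_set d)"
  by (simp add: nsphere nsphere_set_def euclidean_product_topology)

lemma Euclidean_space_eq_top_of_set: "Euclidean_space m = top_of_set {x. \<forall>i\<ge>m. x i = 0}"
  by (simp add: Euclidean_space_def euclidean_product_topology)

text \<open>
  The Brouwer degree lives on the spheres \<open>nsphere d\<close> of real sequences, whereas polynomial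
  approximation and the dimension argument for smooth maps are available in Euclidean spaces. An
  enumeration of the standard basis identifies the two worlds; it also provides a flag of
  coordinate subspaces, so that spheres of all dimensions \<open>d < DIM('a)\<close> are nested in one type and
  induction on \<open>d\<close> makes sense.
\<close>

locale basis_enumeration =
  fixes b :: "nat \<Rightarrow> 'a::euclidean_space"
  assumes b_bij: "bij_betw b {..<DIM('a)} Basis"
begin

definition emb :: "(nat \<Rightarrow> real) \<Rightarrow> 'a" where
  "emb x = (\<Sum>i<DIM('a). x i *\<^sub>R b i)"

definition coord :: "'a \<Rightarrow> nat \<Rightarrow> real" where
  "coord y i = (if i < DIM('a) then y \<bullet> b i else 0)"

definition flag :: "nat \<Rightarrow> 'a set" where
  "flag j = {y. \<forall>i\<in>{j..<DIM('a)}. y \<bullet> b i = 0}"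

definition usphere :: "nat \<Rightarrow> 'a set" where
  "usphere d = sphere 0 1 \<inter> flag (Suc d)"

text \<open>
  The degree of a self-map of \<open>usphere d\<close>, obtained by transport along the coordinate
  homeomorphism with \<open>nsphere d\<close>.
\<close>

definition sdeg :: "nat \<Rightarrow> ('a \<Rightarrow> 'a) \<Rightarrow> int" where
  "sdeg d f = Brouwer_degree2 d (coord \<circ> f \<circ> emb)"

lemma b_Basis: "i < DIM('a) \<Longrightarrow> b i \<in> Basis"
  using b_bij by (auto simp: bij_betw_def)

lemma b_inner: "\<lbrakk>i < DIM('a); j < DIM('a)\<rbrakk> \<Longrightarrow> b i \<bullet> b j = (if i = j then 1 else 0)"
  using b_bij by (auto simp: inner_Basis b_Basis bij_betw_def inj_on_eq_iff)

lemma emb_inner: "j < DIM('a) \<Longrightarrow> emb x \<bullet> b j = x j"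
  by (simp add: emb_def inner_sum_left b_inner if_distrib cong: if_cong)

lemma emb_coord [simp]: "emb (coord y) = y"
proof -
  have "(\<Sum>i<DIM('a). (y \<bullet> b i) *\<^sub>R b i) = (\<Sum>u\<in>Basis. (y \<bullet> u) *\<^sub>R u)"
    by (rule sum.reindex_bij_betw[OF b_bij])
  then show ?thesis
    by (simp add: emb_def coord_def euclidean_representation)
qed

lemma coord_emb: "(\<And>i. i \<ge> DIM('a) \<Longrightarrow> x i = 0) \<Longrightarrow> coord (emb x) = x"
  by (auto simp: coord_def emb_inner)

lemma norm_emb: "(norm (emb x))\<^sup>2 = (\<Sum>i<DIM('a). (x i)\<^sup>2)"
  unfolding power2_norm_eq_inner
  by (subst emb_def, simp add: inner_sum_left inner_commute[of "b _"] emb_inner power2_eq_square)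

lemma emb_minus: "emb (\<lambda>i. - x i) = - emb x"
  by (simp add: emb_def sum_negf)

lemma coord_minus: "coord (- y) = (\<lambda>i. - coord y i)"
  by (auto simp: coord_def)

lemma continuous_emb: "continuous_on X emb"
  unfolding emb_def
  by (intro continuous_intros continuous_on_product_then_coordinatewise continuous_on_id)

lemma continuous_coord: "continuous_on X coord"
  unfolding coord_def
proof (rule continuous_on_coordinatewise_then_product)
  show "continuous_on X (\<lambda>y. if i < DIM('a) then y \<bullet> b i else 0)" for i
    by (cases "i < DIM('a)") (auto intro!: continuous_intros)
qed

lemma subspace_flag: "subspace (flag j)"
  by (auto simp: flag_def subspace_def inner_left_distrib)

lemma flag_mono: "i \<le> j \<Longrightarrow> flag i \<subseteq> flag j"
  by (auto simp: flag_def)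

lemma dim_flag:
  assumes "j \<le> DIM('a)" shows "dim (flag j) = j"
proof -
  have sub: "b ` {..<j} \<subseteq> Basis"
    using assms b_Basis by auto
  have 1: "flag j = span (b ` {..<j})"
  proof
    show "flag j \<subseteq> span (b ` {..<j})"
    proof
      fix y assume y: "y \<in> flag j"
      have "y = (\<Sum>i<DIM('a). (y \<bullet> b i) *\<^sub>R b i)"
        using emb_coord[of y] by (simp add: emb_def coord_def)
      also have "\<dots> = (\<Sum>i<j. (y \<bullet> b i) *\<^sub>R b i)"
        using y assms by (intro sum.mono_neutral_right) (auto simp: flag_def)
      also have "\<dots> \<in> span (b ` {..<j})"
        by (intro span_sum span_scale span_base) auto
      finally show "y \<in> span (b ` {..<j})" .
    qed
    show "span (b ` {..<j}) \<subseteq> flag j"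
      using assms by (intro span_minimal subspace_flag) (auto simp: flag_def b_inner)
  qed
  have "independent (b ` {..<j})"
    using sub independent_Basis independent_mono by blast
  then have "dim (flag j) = card (b ` {..<j})"
    unfolding 1 by (simp add: dim_eq_card_independent)
  also have "\<dots> = j"
    using assms b_bij by (subst card_image) (auto simp: bij_betw_def intro: inj_on_subset)
  finally show ?thesis .
qed

lemma emb_usphere:
  assumes "d < DIM('a)" "x \<in> nsphere_set d" shows "emb x \<in> usphere d"
proof -
  have "(\<Sum>i<DIM('a). (x i)\<^sup>2) = (\<Sum>i\<le>d. (x i)\<^sup>2)"
    using assms by (intro sum.mono_neutral_right) (auto simp: nsphere_set_def not_le)
  then have "(norm (emb x))\<^sup>2 = 1"
    using assms by (simp add: norm_emb nsphere_set_def)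
  then have "norm (emb x) = 1"
    by (simp add: power2_eq_1_iff) (smt (verit) norm_ge_zero)
  then show ?thesis
    using assms by (auto simp: usphere_def flag_def emb_inner nsphere_set_def)
qed

lemma coord_nsphere:
  assumes "d < DIM('a)" "y \<in> usphere d" shows "coord y \<in> nsphere_set d"
proof -
  have 0: "\<forall>i>d. coord y i = 0"
    using assms by (auto simp: usphere_def flag_def coord_def)
  have "(\<Sum>i\<le>d. (coord y i)\<^sup>2) = (\<Sum>i<DIM('a). (coord y i)\<^sup>2)"
    using assms 0 by (intro sum.mono_neutral_left) (auto simp: not_le)
  also have "\<dots> = (norm (emb (coord y)))\<^sup>2"
    by (simp only: norm_emb)
  also have "\<dots> = 1"
    using assms by (simp add: usphere_def)
  finally show ?thesis
    using 0 by (simp add: nsphere_set_def)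
qed

lemma coord_emb_nsphere: "d < DIM('a) \<Longrightarrow> x \<in> nsphere_set d \<Longrightarrow> coord (emb x) = x"
  by (rule coord_emb) (auto simp: nsphere_set_def)

definition self_map :: "nat \<Rightarrow> ('a \<Rightarrow> 'a) \<Rightarrow> bool" where
  "self_map d f \<longleftrightarrow> continuous_on (usphere d) f \<and> f ` usphere d \<subseteq> usphere d"

lemma self_map_nsphere:
  assumes d: "d < DIM('a)" and f: "self_map d f"
  shows "continuous_map (nsphere d) (nsphere d) (coord \<circ> f \<circ> emb)"
proof -
  have "emb ` nsphere_set d \<subseteq> usphere d"
    using d emb_usphere by auto
  then have "continuous_on (nsphere_set d) (f \<circ> emb)"
    using f by (intro continuous_on_compose[OF continuous_emb])
       (auto simp only: self_map_def intro: continuous_on_subset)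
  then have "continuous_on (nsphere_set d) (coord \<circ> (f \<circ> emb))"
    by (rule continuous_on_compose[OF _ continuous_coord])
  moreover have "(coord \<circ> (f \<circ> emb)) ` nsphere_set d \<subseteq> nsphere_set d"
    using f emb_usphere[OF d] coord_nsphere[OF d] by (auto simp: self_map_def image_subset_iff)
  ultimately show ?thesis
    by (auto simp: nsphere_eq_top_of_set o_assoc)
qed

lemma sdeg_cong:
  assumes "d < DIM('a)" "\<And>y. y \<in> usphere d \<Longrightarrow> f y = g y" shows "sdeg d f = sdeg d g"
  unfolding sdeg_def using assms
  by (intro Brouwer_degree2_eq) (auto simp: nsphere_eq_top_of_set emb_usphere)

lemma sdeg_homotopic:
  assumes d: "d < DIM('a)"
    and h: "homotopic_with_canon (\<lambda>_. True) (usphere d) (usphere d) f g"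
  shows "sdeg d f = sdeg d g"
proof -
  have 1: "continuous_map (nsphere d) (top_of_set (usphere d)) emb"
    using d emb_usphere continuous_emb by (auto simp: nsphere_eq_top_of_set)
  have 2: "continuous_map (top_of_set (usphere d)) (nsphere d) coord"
    using d coord_nsphere continuous_coord by (auto simp: nsphere_eq_top_of_set)
  have "homotopic_with (\<lambda>_. True) (nsphere d) (nsphere d) (coord \<circ> (f \<circ> emb)) (coord \<circ> (g \<circ> emb))"
    by (rule homotopic_with_compose_continuous_map_left[OF
          homotopic_with_compose_continuous_map_right[OF h 1] 2]) auto
  then show ?thesis
    unfolding sdeg_def by (simp add: o_assoc Brouwer_degree2_homotopic)
qed

lemma sdeg_compose:
  assumes d: "d < DIM('a)" and f: "self_map d f" and g: "self_map d g"
  shows "sdeg d (g \<circ> f) = sdeg d g * sdeg d f"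
proof -
  have "sdeg d (g \<circ> f) = Brouwer_degree2 d ((coord \<circ> g \<circ> emb) \<circ> (coord \<circ> f \<circ> emb))"
    unfolding sdeg_def by (intro arg_cong[where f = "Brouwer_degree2 d"]) (auto simp: o_def)
  also have "\<dots> = sdeg d g * sdeg d f"
    unfolding sdeg_def by (rule Brouwer_degree2_compose[OF self_map_nsphere[OF d f] self_map_nsphere[OF d g]])
  finally show ?thesis .
qed

lemma sdeg_id:
  assumes d: "d < DIM('a)" shows "sdeg d id = 1"
proof -
  have "sdeg d id = Brouwer_degree2 d id"
    unfolding sdeg_def
    by (rule Brouwer_degree2_eq) (auto simp: nsphere_eq_top_of_set coord_emb_nsphere[OF d])
  then show ?thesis by simp
qed

text \<open>
  Degrees multiply under composition, so the degree of an involution squares to \<open>1\<close>.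
\<close>

lemma sdeg_involution:
  assumes d: "d < DIM('a)" and f: "self_map d f" and ff: "\<And>y. y \<in> usphere d \<Longrightarrow> f (f y) = y"
  shows "odd (sdeg d f)"
proof -
  have "sdeg d f * sdeg d f = sdeg d (f \<circ> f)"
    using sdeg_compose[OF d f f] by simp
  also have "\<dots> = sdeg d id"
    using ff by (intro sdeg_cong[OF d]) auto
  also have "\<dots> = 1"
    by (rule sdeg_id[OF d])
  finally show ?thesis
    by (metis even_mult_iff odd_one)
qed

lemma sdeg_nonsurjective:
  assumes d: "d < DIM('a)" and f: "self_map d f" and ne: "f ` usphere d \<noteq> usphere d"
  shows "sdeg d f = 0"
proof -
  obtain y where y: "y \<in> usphere d" "y \<notin> f ` usphere d"
    using ne f by (auto simp: self_map_def)
  have "coord y \<notin> (coord \<circ> f \<circ> emb) ` nsphere_set d"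
  proof
    assume "coord y \<in> (coord \<circ> f \<circ> emb) ` nsphere_set d"
    then obtain x where "x \<in> nsphere_set d" "coord y = coord (f (emb x))"
      by auto
    then have "y = f (emb x)"
      by (metis emb_coord)
    then show False
      using y d emb_usphere \<open>x \<in> nsphere_set d\<close> by auto
  qed
  moreover have "coord y \<in> nsphere_set d"
    using y d coord_nsphere by auto
  ultimately show ?thesis
    unfolding sdeg_def
    by (intro Brouwer_degree2_nonsurjective self_map_nsphere d f) (auto simp: nsphere_eq_top_of_set)
qed

lemma uminus_usphere: "y \<in> usphere d \<Longrightarrow> - y \<in> usphere d"
  by (auto simp: usphere_def flag_def)

text \<open>
  This drives the induction for \<open>odd_sdeg\<close>: modulo 2, only the action of \<open>f\<close> on the equator matters.
\<close>

lemma sdeg_equator: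
  assumes d: "Suc d < DIM('a)" and f: "self_map (Suc d) f" and odd: "\<And>y. y \<in> usphere (Suc d) \<Longrightarrow> f (- y) = - f y"
    and eq: "f ` usphere d \<subseteq> usphere d"
  shows "even (sdeg (Suc d) f - sdeg d f)"
proof -
  have d': "d < DIM('a)" using d by simp
  have "even (Brouwer_degree2 (Suc d) (coord \<circ> f \<circ> emb) - Brouwer_degree2 (Suc d - Suc 0) (coord \<circ> f \<circ> emb))"
  proof (rule Borsuk_odd_mapping_degree_step)
    show "continuous_map (nsphere (Suc d)) (nsphere (Suc d)) (coord \<circ> f \<circ> emb)"
      using self_map_nsphere d f by blast
    show "((coord \<circ> f \<circ> emb) \<circ> (\<lambda>x i. - x i)) u = ((\<lambda>x i. - x i) \<circ> (coord \<circ> f \<circ> emb)) u"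
      if "u \<in> topspace (nsphere (Suc d))" for u
      using that odd[OF emb_usphere[OF d]] by (simp add: nsphere_eq_top_of_set emb_minus coord_minus)
    show "coord \<circ> f \<circ> emb \<in> topspace (nsphere (Suc d - Suc 0)) \<rightarrow> topspace (nsphere (Suc d - Suc 0))"
      using eq emb_usphere[OF d'] coord_nsphere[OF d'] by (auto simp: nsphere_eq_top_of_set image_subset_iff)
  qed
  then show ?thesis
    by (simp add: sdeg_def)
qed

lemma usphere_0: "usphere 0 = {b 0, - b 0}"
proof -
  have 0: "0 < DIM('a)" by simp
  have "y \<in> {b 0, - b 0}" if y: "y \<in> usphere 0" for y
  proof -
    have c: "coord y \<in> nsphere_set 0" using coord_nsphere[OF 0 y] .
    have "y = emb (coord y)" by simp
    also have "\<dots> = (\<Sum>i<DIM('a). coord y i *\<^sub>R b i)" by (simp add: emb_def)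
    also have "\<dots> = (\<Sum>i\<in>{0}. coord y i *\<^sub>R b i)"
      using c by (intro sum.mono_neutral_right) (auto simp: nsphere_set_def)
    finally have "y = coord y 0 *\<^sub>R b 0" by simp
    moreover have "coord y 0 = 1 \<or> coord y 0 = -1"
      using c by (simp add: nsphere_set_def power2_eq_1_iff)
    ultimately show ?thesis by auto
  qed
  moreover have "b 0 \<in> usphere 0"
    by (auto simp: usphere_def flag_def b_Basis b_inner)
  ultimately show ?thesis using uminus_usphere by auto
qed

definition odd_on :: "'a set \<Rightarrow> ('a \<Rightarrow> 'a) \<Rightarrow> bool" where
  "odd_on S f \<longleftrightarrow> (\<forall>y\<in>S. f (- y) = - f y)"

lemma self_map_compose:
  assumes "self_map d f" "self_map d g" shows "self_map d (g \<circ> f)"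
proof -
  have "continuous_on (usphere d) (g \<circ> f)"
    using assms unfolding self_map_def by (metis continuous_on_compose continuous_on_subset)
  moreover have "(g \<circ> f) ` usphere d \<subseteq> usphere d"
    using assms by (auto simp: self_map_def)
  ultimately show ?thesis
    by (simp add: self_map_def)
qed

lemma flag_scaleR: "y \<in> flag j \<Longrightarrow> c *\<^sub>R y \<in> flag j"
  by (simp add: flag_def)

lemma sgn_usphere: "y \<in> flag (Suc d) \<Longrightarrow> y \<noteq> 0 \<Longrightarrow> sgn y \<in> usphere d"
  by (auto simp: usphere_def norm_sgn sgn_div_norm flag_scaleR)

lemma sgn_of_usphere: "y \<in> usphere d \<Longrightarrow> sgn y = y"
  by (auto simp: usphere_def sgn_div_norm)

lemma self_map_sgn:
  assumes "continuous_on (usphere d) F" "F ` usphere d \<subseteq> flag (Suc d) - {0}"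
  shows "self_map d (sgn \<circ> F)"
  using assms unfolding self_map_def
  by (auto simp: o_def intro!: continuous_intros sgn_usphere)

text \<open>
  Maps into punctured space are handled through their normalisations: if the straight-line
  homotopy never passes through the origin, it can be pushed radially to the sphere.
\<close>

lemma sdeg_sgn_segment:
  assumes d: "d < DIM('a)"
    and F: "continuous_on (usphere d) F" "F ` usphere d \<subseteq> flag (Suc d)"
    and G: "continuous_on (usphere d) G" "G ` usphere d \<subseteq> flag (Suc d)"
    and seg: "\<And>y. y \<in> usphere d \<Longrightarrow> 0 \<notin> closed_segment (F y) (G y)"
  shows "sdeg d (sgn \<circ> F) = sdeg d (sgn \<circ> G)"
proof (rule sdeg_homotopic[OF d])
  have sub: "closed_segment (F y) (G y) \<subseteq> flag (Suc d) - {0}" if "y \<in> usphere d" for y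
    using closed_segment_subset[OF _ _ subspace_imp_convex[OF subspace_flag]] seg[OF that] F(2) G(2) that
    by blast
  have "homotopic_with_canon (\<lambda>_. True) (usphere d) (flag (Suc d) - {0}) F G"
    by (intro homotopic_with_linear F G sub)
  moreover have "continuous_on (flag (Suc d) - {0}) sgn"
    by (intro continuous_on_sgn continuous_on_id) auto
  moreover have "sgn \<in> (flag (Suc d) - {0}) \<rightarrow> usphere d"
    by (auto intro: sgn_usphere)
  ultimately show "homotopic_with_canon (\<lambda>_. True) (usphere d) (usphere d) (sgn \<circ> F) (sgn \<circ> G)"
    by (rule homotopic_with_compose_continuous_left)
qed

lemma compact_usphere: "compact (usphere d)"
  unfolding usphere_def by (simp add: closed_subspace compact_Int_closed subspace_flag)

section \<open>Odd maps have odd degree\<close>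

text \<open>
  A continuous map may send the equator onto the whole sphere, but a smooth one may not, since it
  cannot raise dimension. Stone-Weierstrass supplies a polynomial within distance \<open>1\<close> of \<open>f\<close>, and
  taking its odd part does not increase the distance because \<open>f\<close> is odd itself.
\<close>

lemma odd_approximation_missing_point:
  assumes d: "Suc d < DIM('a)" and f: "self_map (Suc d) f" "odd_on (usphere (Suc d)) f"
  obtains G p where "continuous_on UNIV G" "odd_on UNIV G" "G ` usphere (Suc d) \<subseteq> flag (Suc (Suc d))"
    "\<And>y. y \<in> usphere (Suc d) \<Longrightarrow> norm (f y - G y) < 1"
    "p \<in> usphere (Suc d)" "\<And>y. y \<in> usphere d \<Longrightarrow> sgn (G y) \<noteq> p"
proof -
  obtain g where g: "polynomial_function g" "g ` usphere (Suc d) \<subseteq> flag (Suc (Suc d))"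
      "\<And>y. y \<in> usphere (Suc d) \<Longrightarrow> norm (f y - g y) < 1"
    using f Stone_Weierstrass_polynomial_function_subspace[OF compact_usphere, of "Suc d" f 1 "flag (Suc (Suc d))"]
    by (auto simp: self_map_def subspace_flag) (auto simp: usphere_def)
  define G where "G = (\<lambda>y. (1/2) *\<^sub>R (g y - g (- y)))"
  have G_poly: "polynomial_function G"
  proof -
    have "polynomial_function (g \<circ> uminus)"
      by (intro polynomial_function_compose g polynomial_function_bounded_linear bounded_linear_minus bounded_linear_ident)
    then show ?thesis
      unfolding G_def using g by (intro polynomial_function_cmul polynomial_function_diff) (auto simp: o_def)
  qed
  have G_flag: "G ` usphere (Suc d) \<subseteq> flag (Suc (Suc d))"
    using g(2) uminus_usphere unfolding G_def
    by (auto intro!: flag_scaleR subspace_diff[OF subspace_flag])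
  have G_near: "norm (f y - G y) < 1" if y: "y \<in> usphere (Suc d)" for y
  proof -
    have "f y - G y = (1/2) *\<^sub>R ((f y - g y) - (f (- y) - g (- y)))"
      using f(2) y by (simp add: odd_on_def G_def algebra_simps flip: scaleR_add_left)
    then have "norm (f y - G y) \<le> (1/2) * (norm (f y - g y) + norm (f (- y) - g (- y)))"
      by (simp add: norm_triangle_ineq4)
    also have "\<dots> < 1"
      using g(3)[OF y] g(3)[OF uminus_usphere[OF y]] by simp
    finally show ?thesis .
  qed
  have sub: "usphere d \<subseteq> usphere (Suc d)"
    using flag_mono[of "Suc d" "Suc (Suc d)"] by (auto simp: usphere_def)
  have G_nz: "G y \<noteq> 0" if "y \<in> usphere (Suc d)" for y
  proof
    assume "G y = 0"
    then have "norm (f y) < 1"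
      using G_near[OF that] by simp
    moreover have "f y \<in> usphere (Suc d)"
      using f(1) that by (auto simp: self_map_def)
    ultimately show False
      by (simp add: usphere_def)
  qed
  have "(\<lambda>y. inverse (norm (G y)) *\<^sub>R G y) differentiable_on usphere d"
  proof -
    have G_diff: "G differentiable_on usphere d"
      by (rule differentiable_on_polynomial_function[OF G_poly])
    have "norm differentiable_on G ` usphere d"
      using G_nz sub unfolding differentiable_on_def
      by (auto intro!: differentiable_at_withinI differentiable_norm_at)
    then have "(\<lambda>y. norm (G y)) differentiable_on usphere d"
      by (rule differentiable_on_compose[OF G_diff])
    then show ?thesis
      using G_nz sub by (intro differentiable_on_scaleR differentiable_on_inverse G_diff) auto
  qed
  then have "(\<lambda>y. sgn (G y)) ` usphere d \<noteq> usphere (Suc d)"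
    using d unfolding usphere_def sgn_div_norm
    by (intro spheremap_lemma1) (auto simp: subspace_flag dim_flag flag_mono divide_inverse)
  moreover have "(\<lambda>y. sgn (G y)) ` usphere d \<subseteq> usphere (Suc d)"
    using G_flag G_nz sub by (auto intro!: sgn_usphere)
  ultimately obtain p where p: "p \<in> usphere (Suc d)" "p \<notin> (\<lambda>y. sgn (G y)) ` usphere d"
    by blast
  show thesis
  proof (rule that)
    show "continuous_on UNIV G"
      using G_poly by (simp add: differentiable_imp_continuous_on differentiable_on_polynomial_function)
    show "odd_on UNIV G"
      by (simp add: odd_on_def G_def algebra_simps)
  qed (use p G_flag G_near in auto)
qed

text \<open>
  The Householder reflection in the hyperplane orthogonal to \<open>v\<close>. For \<open>v = 0\<close> the convention
  \<open>x / 0 = 0\<close> makes it the identity, so that \<open>mirror_swap\<close> covers the case \<open>p = q\<close>.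
\<close>

definition mirror :: "'a \<Rightarrow> 'a \<Rightarrow> 'a" where
  "mirror v y = y - (2 * (y \<bullet> v) / (v \<bullet> v)) *\<^sub>R v"

lemma mirror_inner: "mirror v y \<bullet> mirror v z = y \<bullet> z"
proof (cases "v = 0")
  case False
  define c e where "c = 2 * (y \<bullet> v) / (v \<bullet> v)" and "e = 2 * (z \<bullet> v) / (v \<bullet> v)"
  have ce: "c * (v \<bullet> v) = 2 * (y \<bullet> v)" "e * (v \<bullet> v) = 2 * (z \<bullet> v)"
    using False by (auto simp: c_def e_def)
  have "mirror v y \<bullet> mirror v z = y \<bullet> z - e * (y \<bullet> v) - c * (z \<bullet> v) + c * (e * (v \<bullet> v))"
    unfolding mirror_def c_def[symmetric] e_def[symmetric]
    by (simp add: inner_diff_left inner_diff_right inner_commute algebra_simps)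
  moreover have "e * (y \<bullet> v) = c * (z \<bullet> v)"
    by (simp add: c_def e_def)
  ultimately show ?thesis
    by (simp add: ce)
qed (simp add: mirror_def)

lemma mirror_mirror: "mirror v (mirror v y) = y"
proof (cases "v = 0")
  case False
  have "mirror v y \<bullet> v = - (y \<bullet> v)"
    using False by (simp add: mirror_def inner_diff_left)
  then show ?thesis
    by (simp add: mirror_def[of v "mirror v y"]) (simp add: mirror_def)
qed (simp add: mirror_def)

lemma mirror_swap:
  assumes "norm p = 1" "norm q = 1" shows "mirror (p - q) p = q"
proof (cases "p = q")
  case False
  have "p \<bullet> p = 1" "q \<bullet> q = 1"
    using assms by (simp_all add: dot_square_norm)
  then have "(p - q) \<bullet> (p - q) = 2 * (p \<bullet> (p - q))"
    by (simp add: inner_diff_left inner_diff_right inner_commute)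
  moreover have "(p - q) \<bullet> (p - q) \<noteq> 0"
    using False by simp
  ultimately show ?thesis
    by (simp add: mirror_def)
qed (simp add: mirror_def)

lemma self_map_mirror:
  assumes "v \<in> flag (Suc d)" shows "self_map d (mirror v)"
proof -
  have "norm (mirror v y) = norm y" for y
    by (simp add: norm_eq_sqrt_inner mirror_inner)
  moreover have "mirror v y \<in> flag (Suc d)" if "y \<in> flag (Suc d)" for y
    unfolding mirror_def by (intro subspace_diff[OF subspace_flag] flag_scaleR that assms)
  moreover have "continuous_on (usphere d) (mirror v)"
  proof -
    have "mirror v = (\<lambda>y. y - (y \<bullet> v) *\<^sub>R ((2 / (v \<bullet> v)) *\<^sub>R v))"
      by (simp add: mirror_def fun_eq_iff)
    then show ?thesis
      by (simp only:) (intro continuous_intros)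
  qed
  ultimately show ?thesis
    by (auto simp: self_map_def usphere_def)
qed

lemma usphere_mono: "d \<le> d' \<Longrightarrow> usphere d \<subseteq> usphere d'"
  using flag_mono[of "Suc d" "Suc d'"] by (auto simp: usphere_def)

text \<open>
  On \<open>usphere 0\<close>, a pair of antipodal points, an odd map is the identity or the antipodal map, hence
  an involution. In the inductive step \<open>f\<close> is replaced by a map \<open>h\<close> that preserves the equator and
  has degree \<open>\<plusminus>deg f\<close>; then \<open>sdeg_equator\<close> applies.
\<close>

lemma odd_sdeg:
  assumes "d < DIM('a)" "self_map d f" "odd_on (usphere d) f"
  shows "odd (sdeg d f)"
  using assms
proof (induction d arbitrary: f)
  case 0
  have b0: "b 0 \<in> usphere 0"
    by (simp add: usphere_0)
  then have f0: "f (- b 0) = - f (b 0)"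
    using 0(3) unfolding odd_on_def by blast
  have "f (b 0) = b 0 \<or> f (b 0) = - b 0"
    using b0 0(2) unfolding self_map_def usphere_0 by blast
  with f0 have "f (f y) = y" if "y = b 0 \<or> y = - b 0" for y
    using that by (elim disjE) simp_all
  then show ?case
    by (intro sdeg_involution 0) (simp add: usphere_0)
next
  case (Suc d)
  note d = Suc.prems(1)
  obtain G p where G: "continuous_on UNIV G" "odd_on UNIV G" "G ` usphere (Suc d) \<subseteq> flag (Suc (Suc d))"
    "\<And>y. y \<in> usphere (Suc d) \<Longrightarrow> norm (f y - G y) < 1"
    and p: "p \<in> usphere (Suc d)" "\<And>y. y \<in> usphere d \<Longrightarrow> sgn (G y) \<noteq> p"
    using odd_approximation_missing_point[OF Suc.prems] by metis
  have f_norm: "norm (f y) = 1" "f y \<in> flag (Suc (Suc d))" if "y \<in> usphere (Suc d)" for y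
  proof -
    have "f y \<in> usphere (Suc d)"
      using Suc.prems(2) that by (auto simp: self_map_def)
    then show "norm (f y) = 1" "f y \<in> flag (Suc (Suc d))"
      by (auto simp: usphere_def)
  qed
  have pp: "p \<bullet> p = 1" and pf: "p \<in> flag (Suc (Suc d))"
    using p(1) by (auto simp: usphere_def dot_square_norm)
  have fG: "0 \<notin> closed_segment (f y) (G y)" if "y \<in> usphere (Suc d)" for y
    using G(4)[OF that] f_norm[OF that] by (auto simp: norm_minus_commute dest: segment_bound)
  have G_nz: "G y \<noteq> 0" if "y \<in> usphere (Suc d)" for y
    using fG[OF that] by (metis ends_in_segment(2))
  let ?q = "b (Suc d)"
  \<comment> \<open>\<open>L s\<close> scales the component of \<open>G\<close> along \<open>p\<close> by \<open>s\<close>. With \<open>s = \<bar>y \<bullet> b (Suc d)\<bar>\<close>, which is even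
    in \<open>y\<close> and zero exactly on the equator, \<open>L1\<close> is odd and maps the equator orthogonally to \<open>p\<close>.\<close>
  define L where "L s y = G y - ((1 - s) * (G y \<bullet> p)) *\<^sub>R p" for s y
  define L1 where "L1 y = L \<bar>y \<bullet> ?q\<bar> y" for y
  have L_nz: "L s y \<noteq> 0" if y: "y \<in> usphere (Suc d)" and s: "s \<ge> 0" "s = 0 \<Longrightarrow> y \<bullet> ?q = 0" for s y
  proof
    assume "L s y = 0"
    then have Gy: "G y = ((1 - s) * (G y \<bullet> p)) *\<^sub>R p"
      by (simp add: L_def)
    then have "G y \<bullet> p = (1 - s) * (G y \<bullet> p)"
      by (metis inner_scaleR_left pp mult.right_neutral)
    moreover have ne: "G y \<bullet> p \<noteq> 0"
      using Gy G_nz[OF y] by auto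
    ultimately have "s = 0"
      by simp
    with s y have "y \<in> usphere d"
      by (auto simp: usphere_def flag_def) (metis Suc_leI atLeastLessThan_iff le_neq_implies_less)
    have "G y = (G y \<bullet> p) *\<^sub>R p"
      using Gy \<open>s = 0\<close> by simp
    then have "sgn (G y) = sgn (G y \<bullet> p) *\<^sub>R sgn p"
      by (metis sgn_scaleR)
    then have "sgn (G y) = p \<or> sgn (G y) = - p"
      using ne sgn_of_usphere[OF p(1)] by (auto simp: sgn_real_def)
    moreover have "sgn (G (- y)) = - sgn (G y)"
      using G(2) by (simp add: odd_on_def sgn_minus)
    ultimately show False
      using p(2)[OF \<open>y \<in> usphere d\<close>] p(2)[OF uminus_usphere[OF \<open>y \<in> usphere d\<close>]] by auto
  qed
  have L_flag: "L s y \<in> flag (Suc (Suc d))" if "y \<in> usphere (Suc d)" for s y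
    unfolding L_def using G(3) that pf by (intro subspace_diff[OF subspace_flag] flag_scaleR) auto
  have L1_nz: "L1 y \<noteq> 0" if "y \<in> usphere (Suc d)" for y
    unfolding L1_def by (rule L_nz[OF that]) auto
  have L1_cont: "continuous_on X L1" for X
    unfolding L1_def L_def using G(1) by (intro continuous_intros) (auto intro: continuous_on_subset)
  have GL: "0 \<notin> closed_segment (G y) (L1 y)" if y: "y \<in> usphere (Suc d)" for y
  proof
    assume "0 \<in> closed_segment (G y) (L1 y)"
    then obtain u where u: "0 \<le> u" "u \<le> 1" "0 = (1 - u) *\<^sub>R G y + u *\<^sub>R L1 y"
      by (auto simp: closed_segment_def)
    \<comment> \<open>points on the segment from \<open>G y\<close> to \<open>L1 y\<close> are again of the form \<open>L s y\<close>\<close>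
    then have "L ((1 - u) + u * \<bar>y \<bullet> ?q\<bar>) y = 0"
      by (simp add: L1_def L_def algebra_simps)
    moreover have "y \<bullet> ?q = 0" if "(1 - u) + u * \<bar>y \<bullet> ?q\<bar> = 0"
      using u(1,2) that by (smt (verit) mult_nonneg_nonneg mult_cancel_right1 mult_eq_0_iff)
    ultimately show False
      using L_nz[OF y, of "(1 - u) + u * \<bar>y \<bullet> ?q\<bar>"] u(1,2) by auto
  qed
  have "sdeg (Suc d) f = sdeg (Suc d) (sgn \<circ> f)"
    using Suc.prems(2) by (intro sdeg_cong[OF d]) (auto simp: self_map_def sgn_of_usphere)
  also have "\<dots> = sdeg (Suc d) (sgn \<circ> G)"
    using Suc.prems(2) G(1,3) f_norm fG
    by (intro sdeg_sgn_segment[OF d]) (auto simp: self_map_def intro: continuous_on_subset)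
  also have "\<dots> = sdeg (Suc d) (sgn \<circ> L1)"
    using G(1,3) GL L_flag L1_cont
    by (intro sdeg_sgn_segment[OF d]) (auto simp: L1_def intro: continuous_on_subset)
  finally have f_L1: "sdeg (Suc d) f = sdeg (Suc d) (sgn \<circ> L1)" .
  have L1_map: "self_map (Suc d) (sgn \<circ> L1)"
    using L_flag L1_nz L1_cont by (intro self_map_sgn) (auto simp: L1_def)
  let ?m = "mirror (p - ?q)"
  have q: "?q \<in> usphere (Suc d)"
    using d by (auto simp: usphere_def flag_def b_Basis b_inner)
  have pq: "p - ?q \<in> flag (Suc (Suc d))"
    using pf q by (auto simp: usphere_def intro: subspace_diff[OF subspace_flag])
  have m_map: "self_map (Suc d) ?m"
    by (rule self_map_mirror[OF pq])
  have m_odd: "odd (sdeg (Suc d) ?m)"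
    by (rule sdeg_involution[OF d m_map mirror_mirror])
  define h where "h = ?m \<circ> (sgn \<circ> L1)"
  have h_map: "self_map (Suc d) h"
    unfolding h_def by (rule self_map_compose[OF L1_map m_map])
  have h_odd: "odd_on (usphere (Suc d)) h"
  proof -
    have "L1 (- y) = - L1 y" for y
      using G(2) by (simp add: odd_on_def L1_def L_def)
    moreover have "mirror v (- y) = - mirror v y" for v y
      by (simp add: mirror_def)
    ultimately show ?thesis
      by (simp add: odd_on_def h_def sgn_minus)
  qed
  have h_eq: "h ` usphere d \<subseteq> usphere d"
  proof clarify
    fix y assume y: "y \<in> usphere d"
    then have y': "y \<in> usphere (Suc d)" and yq: "y \<bullet> ?q = 0"
      using d usphere_mono[of d "Suc d"] by (auto simp: usphere_def flag_def)
    have "L1 y \<bullet> p = 0"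
      by (simp add: L1_def L_def yq inner_diff_left pp)
    then have "sgn (L1 y) \<bullet> p = 0"
      by (simp add: sgn_div_norm)
    moreover have "?m p = ?q"
      using p(1) q by (intro mirror_swap) (auto simp: usphere_def)
    ultimately have "h y \<bullet> ?q = 0"
      using mirror_inner[of "p - ?q" "sgn (L1 y)" p] by (simp add: h_def)
    moreover have "h y \<in> usphere (Suc d)"
      using h_map y' by (auto simp: self_map_def)
    ultimately show "h y \<in> usphere d"
      by (auto simp: usphere_def flag_def) (metis Suc_leI atLeastLessThan_iff le_neq_implies_less)
  qed
  have sub: "usphere d \<subseteq> usphere (Suc d)"
    by (simp add: usphere_mono)
  have "odd (sdeg d h)"
    using h_map h_odd h_eq sub d
    by (intro Suc.IH) (auto simp: self_map_def odd_on_def intro: continuous_on_subset)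
  moreover have "even (sdeg (Suc d) h - sdeg d h)"
    using h_odd by (intro sdeg_equator d h_map h_eq) (auto simp: odd_on_def)
  ultimately have "odd (sdeg (Suc d) h)"
    by simp
  moreover have "sdeg (Suc d) h = sdeg (Suc d) ?m * sdeg (Suc d) f"
    unfolding h_def f_L1 by (rule sdeg_compose[OF d L1_map m_map])
  ultimately show ?case
    by simp
qed

text \<open>
  A zero-free odd map into the smaller subspace would, after normalisation, be an odd self-map of
  \<open>usphere d\<close> that misses the pole \<open>b d\<close> and so has degree \<open>0\<close>, which is even.
\<close>

theorem Borsuk_Ulam:
  assumes d: "d < DIM('a)" and g: "continuous_on (usphere d) g" "odd_on (usphere d) g"
    and im: "g ` usphere d \<subseteq> flag d"
  shows "\<exists>y\<in>usphere d. g y = 0"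
proof (rule ccontr)
  assume "\<not> ?thesis"
  then have nz: "g y \<noteq> 0" if "y \<in> usphere d" for y
    using that by blast
  have fl: "g ` usphere d \<subseteq> flag (Suc d) - {0}"
    using im nz flag_mono[of d "Suc d"] by auto
  have map: "self_map d (sgn \<circ> g)"
    by (rule self_map_sgn[OF g(1) fl])
  have "sgn (g y) \<noteq> b d" if "y \<in> usphere d" for y
  proof
    assume "sgn (g y) = b d"
    moreover have "sgn (g y) \<in> flag d"
      using im that by (auto simp: sgn_div_norm intro: flag_scaleR)
    ultimately have "b d \<bullet> b d = 0"
      using d by (simp add: flag_def)
    then show False
      using d by (simp add: b_inner)
  qed
  moreover have "b d \<in> usphere d"
    using d by (auto simp: usphere_def flag_def b_Basis b_inner)
  ultimately have "sdeg d (sgn \<circ> g) = 0"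
    by (intro sdeg_nonsurjective[OF d map]) (metis comp_apply imageE)
  moreover have "odd (sdeg d (sgn \<circ> g))"
    using g(2) by (intro odd_sdeg d map) (auto simp: odd_on_def sgn_minus)
  ultimately show False
    by simp
qed

section \<open>Lower bounds for the genus\<close>

text \<open>
  An odd zero-free map from \<open>S\<close> into a space of dimension at most \<open>d\<close>, composed with \<open>\<phi>\<close>, would
  contradict the Borsuk-Ulam theorem. The genus is a \<open>LEAST\<close>, so it must also be checked that
  some odd map exists at all: the coordinates themselves provide one, as \<open>0 \<notin> S\<close>.
\<close>

lemma genus_ge_of_odd_sphere_map:
  assumes d: "d < DIM('a)" and \<phi>: "continuous_on (usphere d) \<phi>" "odd_on (usphere d) \<phi>"
    and S: "\<phi> ` usphere d \<subseteq> S" "0 \<notin> S"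
  shows "Suc d \<le> genus S"
proof (rule ccontr)
  assume "\<not> Suc d \<le> genus S"
  then have le: "genus S \<le> d" by simp
  have coord_nz: "coord x \<noteq> (\<lambda>i. 0)" if "x \<noteq> 0" for x
  proof
    assume "coord x = (\<lambda>i. 0)"
    then have "x = emb (\<lambda>i. 0)"
      using emb_coord[of x] by simp
    then show False
      using that by (simp add: emb_def)
  qed
  \<comment> \<open>the set over which the genus is a minimum is nonempty\<close>
  have "odd_map_into S (DIM('a)) coord"
  proof -
    have "coord x \<noteq> (\<lambda>i. 0)" if "x \<in> S" for x
      using coord_nz S(2) that by metis
    then show ?thesis
      by (auto simp: odd_map_into_def Euclidean_space_eq_top_of_set continuous_coord coord_minus)
         (auto simp: coord_def)
  qed
  then have "\<exists>m. m \<ge> 1 \<and> (\<exists>f. odd_map_into S m f)"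
    by (intro exI[of _ "DIM('a)"]) (auto simp: Suc_le_eq)
  from LeastI_ex[OF this] obtain f where f: "odd_map_into S (genus S) f"
    unfolding genus_def by blast
  then have f_cont: "continuous_on S f" and f0: "\<And>x i. \<lbrakk>x \<in> S; i \<ge> genus S\<rbrakk> \<Longrightarrow> f x i = 0"
    by (auto simp: odd_map_into_def Euclidean_space_eq_top_of_set)
  define g where "g = emb \<circ> (f \<circ> \<phi>)"
  have "continuous_on (usphere d) (f \<circ> \<phi>)"
    using \<phi>(1) f_cont S(1) by (metis continuous_on_compose continuous_on_subset)
  then have g_cont: "continuous_on (usphere d) g"
    unfolding g_def by (rule continuous_on_compose[OF _ continuous_emb])
  have g_odd: "odd_on (usphere d) g"
    using \<phi>(2) S(1) f by (auto simp: odd_on_def g_def odd_map_into_def image_subset_iff emb_minus)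
  have "g ` usphere d \<subseteq> flag d"
    using S(1) f0 le by (auto simp: g_def flag_def emb_inner image_subset_iff)
  then obtain y where y: "y \<in> usphere d" "g y = 0"
    using Borsuk_Ulam[OF d g_cont g_odd] by blast
  have \<phi>y: "\<phi> y \<in> S"
    using S(1) y by auto
  have "f (\<phi> y) i = 0" for i
  proof (cases "i < DIM('a)")
    case True
    then show ?thesis
      using y(2) emb_inner[OF True, of "f (\<phi> y)"] by (simp add: g_def)
  next
    case False
    then show ?thesis
      using f0[OF \<phi>y] le d by simp
  qed
  then have "f (\<phi> y) = (\<lambda>i. 0)"
    by (rule ext)
  then show False
    using f \<phi>y unfolding odd_map_into_def by blast
qed

lemma usphere_coordinate_nonzero:
  assumes "y \<in> usphere d" obtains i where "i \<le> d" "y \<bullet> b i \<noteq> 0"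
proof -
  have "\<exists>i\<le>d. y \<bullet> b i \<noteq> 0"
  proof (rule ccontr)
    assume "\<not> ?thesis"
    then have "y \<bullet> b i = 0" if "i < DIM('a)" for i
      using assms that by (cases "i \<le> d") (auto simp: usphere_def flag_def)
    then have "coord y = (\<lambda>i. 0)"
      by (auto simp: coord_def)
    then have "y = 0"
      using emb_coord[of y] by (simp add: emb_def)
    then show False
      using assms by (simp add: usphere_def)
  qed
  then show thesis
    using that by blast
qed

end

section \<open>Total variation and cuts\<close>

definition cut_weight :: "'n::finite set set \<Rightarrow> ('n set \<Rightarrow> real) \<Rightarrow> 'n set \<Rightarrow> real" where
  "cut_weight E w A = (\<Sum>e\<in>edge_boundary E A. w e)"

definition variation :: "'n::finite set set \<Rightarrow> ('n set \<Rightarrow> real) \<Rightarrow> real ^ 'n \<Rightarrow> real" where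
  "variation E w x = (\<Sum>e\<in>E. w e * edge_diff x e)"

definition mass :: "('n::finite \<Rightarrow> real) \<Rightarrow> real ^ 'n \<Rightarrow> real" where
  "mass \<mu> x = (\<Sum>v\<in>UNIV. \<mu> v * \<bar>x $ v\<bar>)"

definition indicator_vec :: "'n::finite set \<Rightarrow> real ^ 'n" where
  "indicator_vec A = (\<chi> v. if v \<in> A then 1 else 0)"

lemma indicator_vec_nth [simp]: "indicator_vec A $ v = (if v \<in> A then 1 else 0)"
  by (simp add: indicator_vec_def)

lemma rayleigh_eq: "rayleigh E \<mu> w x = variation E w x / mass \<mu> x"
  by (simp add: rayleigh_def variation_def mass_def)

lemma expansion_eq: "expansion E \<mu> w A = cut_weight E w A / sum \<mu> A"
  by (simp add: expansion_def cut_weight_def)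

lemma edgeE:
  assumes "weighted_graph E \<mu> w" "e \<in> E"
  obtains u v where "e = {u, v}" "u \<noteq> v"
  using assms unfolding weighted_graph_def by blast

lemma weight_pos:
  assumes "weighted_graph E \<mu> w" shows "e \<in> E \<Longrightarrow> w e > 0" "\<mu> v > 0"
  using assms by (auto simp: weighted_graph_def)

lemma edge_diff_nonneg: "weighted_graph E \<mu> w \<Longrightarrow> e \<in> E \<Longrightarrow> edge_diff x e \<ge> 0"
  by (erule (1) edgeE) simp

lemma variation_nonneg: "weighted_graph E \<mu> w \<Longrightarrow> variation E w x \<ge> 0"
  unfolding variation_def
  by (intro sum_nonneg mult_nonneg_nonneg edge_diff_nonneg less_imp_le weight_pos) auto

lemma mass_pos:
  assumes G: "weighted_graph E \<mu> w" and "x \<noteq> 0" shows "mass \<mu> x > 0"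
proof -
  obtain v where "x $ v \<noteq> 0"
    using \<open>x \<noteq> 0\<close> by (auto simp: vec_eq_iff)
  then show ?thesis
    unfolding mass_def using weight_pos(2)[OF G]
    by (intro sum_pos2[of _ v]) (auto simp: less_imp_le)
qed

lemma volume_pos: "weighted_graph E \<mu> w \<Longrightarrow> A \<noteq> {} \<Longrightarrow> sum \<mu> A > 0"
  using weight_pos(2) by (metis finite sum_pos)

lemma mass_indicator_vec: "weighted_graph E \<mu> w \<Longrightarrow> mass \<mu> (indicator_vec A) = sum \<mu> A"
  unfolding mass_def by (simp add: if_distrib sum.If_cases cong: if_cong)

lemma variation_indicator_vec:
  assumes G: "weighted_graph E \<mu> w" shows "variation E w (indicator_vec A) = cut_weight E w A"
proof -
  have "w e * edge_diff (indicator_vec A) e = (if e \<in> edge_boundary E A then w e else 0)" if "e \<in> E" for e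
    using G that
    by (rule edgeE) (use that in \<open>auto simp: edge_boundary_def doubleton_eq_iff insert_commute\<close>)
  then have "variation E w (indicator_vec A) = (\<Sum>e\<in>E. if e \<in> edge_boundary E A then w e else 0)"
    unfolding variation_def by (intro sum.cong) auto
  also have "\<dots> = (\<Sum>e\<in>E \<inter> edge_boundary E A. w e)"
    by (simp add: sum.If_cases Int_def)
  also have "E \<inter> edge_boundary E A = edge_boundary E A"
    by (auto simp: edge_boundary_def)
  finally show ?thesis
    by (simp add: cut_weight_def)
qed

lemma variation_add_le:
  assumes G: "weighted_graph E \<mu> w" shows "variation E w (x + y) \<le> variation E w x + variation E w y"
proof -
  have "edge_diff (x + y) e \<le> edge_diff x e + edge_diff y e" if "e \<in> E" for e
    using G that by (rule edgeE) auto
  then show ?thesis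
    unfolding variation_def sum.distrib[symmetric] distrib_left[symmetric]
    by (intro sum_mono mult_left_mono) (auto intro: less_imp_le weight_pos(1)[OF G])
qed

lemma variation_scaleR:
  assumes G: "weighted_graph E \<mu> w" shows "variation E w (c *\<^sub>R x) = \<bar>c\<bar> * variation E w x"
proof -
  have "edge_diff (c *\<^sub>R x) e = \<bar>c\<bar> * edge_diff x e" if "e \<in> E" for e
    using G that by (rule edgeE) (auto simp flip: abs_mult right_diff_distrib)
  then show ?thesis
    unfolding variation_def sum_distrib_left by (intro sum.cong) auto
qed

lemma variation_sum_le:
  assumes G: "weighted_graph E \<mu> w" and "finite I"
  shows "variation E w (\<Sum>i\<in>I. x i) \<le> (\<Sum>i\<in>I. variation E w (x i))"
  using \<open>finite I\<close>
proof induction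
  case empty
  show ?case
    using variation_scaleR[OF G, of 0] by simp
next
  case (insert i I)
  then show ?case
    using variation_add_le[OF G, of "x i" "sum x I"] by simp
qed

text \<open>
  The variation is additive for pairs of vectors that vary in compatible directions along every
  edge. All decompositions below (into disconnected pieces, into layers, into positive and negative
  part) are of this kind.
\<close>

lemma variation_add:
  assumes G: "weighted_graph E \<mu> w"
    and "\<And>u v. {u, v} \<in> E \<Longrightarrow> \<bar>(x + y) $ u - (x + y) $ v\<bar> = \<bar>x $ u - x $ v\<bar> + \<bar>y $ u - y $ v\<bar>"
  shows "variation E w (x + y) = variation E w x + variation E w y"
proof -
  have "edge_diff (x + y) e = edge_diff x e + edge_diff y e" if "e \<in> E" for e
    using G that by (rule edgeE) (use assms(2) that in auto)
  then show ?thesis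
    unfolding variation_def sum.distrib[symmetric] distrib_left[symmetric]
    by (intro sum.cong) auto
qed

lemma cheeger_attained:
  assumes "k \<in> {1..CARD('n)}"
  obtains A where "A \<in> disjoint_tuples k"
    "\<And>i. i \<in> {1..k} \<Longrightarrow> expansion E \<mu> w (A i) \<le> cheeger (E :: 'n::finite set set) \<mu> w k"
proof -
  let ?g = "\<lambda>A. MAX i\<in>{1..k}. expansion E \<mu> w (A i)"
  have "cheeger E \<mu> w k \<in> ?g ` disjoint_tuples k"
    unfolding cheeger_def using assms
    by (intro Min_in) (auto simp: finite_disjoint_tuples disjoint_tuples_nonempty)
  then obtain A where "A \<in> disjoint_tuples k" "cheeger E \<mu> w k = ?g A"
    by auto
  then show thesis
    by (intro that[of A]) auto
qed

lemma cheeger_le_some_expansion: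
  fixes E :: "'n::finite set set"
  assumes A: "A \<in> disjoint_tuples k" and "k \<ge> 1"
  shows "\<exists>i\<in>{1..k}. cheeger E \<mu> w k \<le> expansion E \<mu> w (A i)"
proof -
  let ?g = "\<lambda>A. MAX i\<in>{1..k}. expansion E \<mu> w (A i)"
  have "cheeger E \<mu> w k \<le> ?g A"
    unfolding cheeger_def using A finite_disjoint_tuples by (intro Min_le) auto
  moreover have "?g A \<in> (\<lambda>i. expansion E \<mu> w (A i)) ` {1..k}"
    using \<open>k \<ge> 1\<close> by (intro Max_in) auto
  ultimately show ?thesis
    by auto
qed

lemma combination_nth:
  assumes dj: "disjoint_family_on A I" and I: "finite I" and j: "j \<in> I" "v \<in> A j"
  shows "(\<Sum>i\<in>I. t i *\<^sub>R indicator_vec (A i)) $ v = t j"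
proof -
  have "v \<notin> A i" if "i \<in> I - {j}" for i
    using dj j that by (auto simp: disjoint_family_on_def)
  then have "(\<Sum>i\<in>I. t i * indicator_vec (A i) $ v) = t j"
    using I j by (subst sum.remove[of I j]) auto
  then show ?thesis
    by (simp only: sum_component vector_scaleR_component real_scaleR_def)
qed

text \<open>
  Disjointness makes the mass of the combination the sum of \<open>\<bar>t i\<bar>\<close> times the volumes, and the
  variation is at most the sum of \<open>\<bar>t i\<bar>\<close> times the cuts; now compare term by term.
\<close>

lemma rayleigh_combination_le:
  fixes E :: "'n::finite set set"
  assumes G: "weighted_graph E \<mu> w"
    and dj: "disjoint_family_on A I" and I: "finite I" and ne: "\<And>i. i \<in> I \<Longrightarrow> A i \<noteq> {}"
    and h: "\<And>i. i \<in> I \<Longrightarrow> expansion E \<mu> w (A i) \<le> h"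
    and nz: "(\<Sum>i\<in>I. t i *\<^sub>R indicator_vec (A i)) \<noteq> 0"
  shows "rayleigh E \<mu> w (\<Sum>i\<in>I. t i *\<^sub>R indicator_vec (A i)) \<le> h"
proof -
  let ?x = "\<Sum>i\<in>I. t i *\<^sub>R indicator_vec (A i)"
  have abs_x: "\<bar>?x $ v\<bar> = (\<Sum>i\<in>I. \<bar>t i\<bar> * indicator_vec (A i) $ v)" for v
  proof (cases "\<exists>j\<in>I. v \<in> A j")
    case True
    then obtain j where j: "j \<in> I" "v \<in> A j"
      by blast
    have "(\<Sum>i\<in>I. \<bar>t i\<bar> * indicator_vec (A i) $ v) = \<bar>t j\<bar>"
      using combination_nth[OF dj I j, of "\<lambda>i. \<bar>t i\<bar>"] by (simp only: sum_component vector_scaleR_component real_scaleR_def)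
    then show ?thesis
      by (simp only: combination_nth[OF dj I j])
  next
    case False
    then show ?thesis
      by (auto simp: sum_component)
  qed
  have "mass \<mu> ?x = (\<Sum>v\<in>UNIV. \<Sum>i\<in>I. \<bar>t i\<bar> * (\<mu> v * \<bar>indicator_vec (A i) $ v\<bar>))"
    unfolding mass_def abs_x sum_distrib_left by (intro sum.cong) auto
  also have "\<dots> = (\<Sum>i\<in>I. \<bar>t i\<bar> * mass \<mu> (indicator_vec (A i)))"
    unfolding mass_def sum_distrib_left by (rule sum.swap)
  finally have mass_x: "mass \<mu> ?x = (\<Sum>i\<in>I. \<bar>t i\<bar> * sum \<mu> (A i))"
    by (simp add: mass_indicator_vec[OF G])
  have "variation E w ?x \<le> (\<Sum>i\<in>I. variation E w (t i *\<^sub>R indicator_vec (A i)))"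
    by (rule variation_sum_le[OF G I])
  also have "\<dots> = (\<Sum>i\<in>I. \<bar>t i\<bar> * cut_weight E w (A i))"
    by (simp add: variation_scaleR[OF G] variation_indicator_vec[OF G])
  also have "\<dots> \<le> (\<Sum>i\<in>I. \<bar>t i\<bar> * (h * sum \<mu> (A i)))"
    using h volume_pos[OF G ne]
    by (intro sum_mono mult_left_mono) (auto simp: expansion_eq divide_le_eq)
  also have "\<dots> = h * mass \<mu> ?x"
    by (simp add: mass_x sum_distrib_left mult.left_commute)
  finally show ?thesis
    using mass_pos[OF G nz] by (simp add: rayleigh_eq divide_le_eq)
qed

text \<open>
  Connectedness of the subgraph induced on \<open>C\<close>, in the form in which it is used below: every proper
  part of \<open>C\<close> is joined to the rest of \<open>C\<close> by an edge.
\<close>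

definition linked :: "'n set set \<Rightarrow> 'n set \<Rightarrow> bool" where
  "linked E C \<longleftrightarrow> C \<noteq> {} \<and> (\<forall>D. D \<subseteq> C \<and> D \<noteq> {} \<and> D \<noteq> C \<longrightarrow> (\<exists>u\<in>D. \<exists>v\<in>C - D. {u, v} \<in> E))"

text \<open>
  If \<open>C\<close> splits into two parts with no edge between them, then both its cut and its volume are sums
  over the parts, so one part expands no more than \<open>C\<close>. Hence a set of low expansion of minimal
  cardinality is connected.
\<close>

lemma linked_subset_low_expansion:
  fixes E :: "'n::finite set set"
  assumes G: "weighted_graph E \<mu> w" and A: "A \<noteq> {}" "cut_weight E w A < h * sum \<mu> A"
  obtains C where "C \<subseteq> A" "linked E C" "cut_weight E w C < h * sum \<mu> C"
proof -
  define P where "P C \<longleftrightarrow> C \<subseteq> A \<and> C \<noteq> {} \<and> cut_weight E w C < h * sum \<mu> C" for C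
  have "P A"
    using A by (simp add: P_def)
  then obtain C where C: "P C" "\<And>D. P D \<Longrightarrow> card C \<le> card D"
    using ex_has_least_nat[of P A card] by blast
  have "\<exists>u\<in>D. \<exists>v\<in>C - D. {u, v} \<in> E" if D: "D \<subseteq> C" "D \<noteq> {}" "D \<noteq> C" for D
  proof (rule ccontr)
    assume no: "\<not> ?thesis"
    have split: "indicator_vec C = indicator_vec D + indicator_vec (C - D)"
      using D by (auto simp: vec_eq_iff)
    have "variation E w (indicator_vec C) = variation E w (indicator_vec D) + variation E w (indicator_vec (C - D))"
      unfolding split
    proof (rule variation_add[OF G])
      fix u v assume "{u, v} \<in> E"
      with no have "\<not> (u \<in> D \<and> v \<in> C - D)" "\<not> (v \<in> D \<and> u \<in> C - D)"
        by (metis insert_commute)+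
      then show "\<bar>(indicator_vec D + indicator_vec (C - D)) $ u - (indicator_vec D + indicator_vec (C - D)) $ v\<bar> =
          \<bar>indicator_vec D $ u - indicator_vec D $ v\<bar> + \<bar>indicator_vec (C - D) $ u - indicator_vec (C - D) $ v\<bar>"
        by auto
    qed
    then have "cut_weight E w C = cut_weight E w D + cut_weight E w (C - D)"
      by (simp add: variation_indicator_vec[OF G])
    moreover have "sum \<mu> C = sum \<mu> D + sum \<mu> (C - D)"
      using D by (metis add.commute finite sum.subset_diff)
    ultimately have "cut_weight E w D < h * sum \<mu> D \<or> cut_weight E w (C - D) < h * sum \<mu> (C - D)"
      using C(1) by (auto simp: P_def distrib_left)
    then have "P D \<or> P (C - D)"
      using C(1) D by (auto simp: P_def)
    moreover have "card D < card C" "card (C - D) < card C"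
      using D by (auto intro!: psubset_card_mono)
    ultimately show False
      using C(2) by force
  qed
  then show thesis
    using C(1) by (intro that[of C]) (auto simp: P_def linked_def)
qed

text \<open>
  A discrete co-area argument: peel off the lowest layer \<open>s 1\<^sub>A\<close>, where \<open>A\<close> is the support of \<open>x\<close>
  and \<open>s\<close> its least positive value. Both the mass and the variation split additively, and the
  support of the rest is strictly smaller.
\<close>

lemma layer_cake_nonneg:
  fixes E :: "'n::finite set set"
  assumes G: "weighted_graph E \<mu> w"
    and cut: "\<And>A. A \<noteq> {} \<Longrightarrow> A \<inter> Q = {} \<Longrightarrow> h * sum \<mu> A \<le> cut_weight E w A"
    and "\<And>v. x $ v \<ge> 0" "\<And>v. v \<in> Q \<Longrightarrow> x $ v = 0"
  shows "h * mass \<mu> x \<le> variation E w x"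
  using assms(3,4)
proof (induction "card {v. x $ v \<noteq> 0}" arbitrary: x rule: less_induct)
  case less
  define A where "A = {v. x $ v \<noteq> 0}"
  show ?case
  proof (cases "A = {}")
    case True
    then have "mass \<mu> x = 0"
      by (simp add: A_def mass_def)
    then show ?thesis
      using variation_nonneg[OF G] by simp
  next
    case False
    define s where "s = Min (($) x ` A)"
    have "s \<in> ($) x ` A"
      unfolding s_def using False by (intro Min_in) auto
    then obtain a where a: "a \<in> A" "s = x $ a"
      by auto
    have s: "s \<le> x $ v" if "v \<in> A" for v
      unfolding s_def using that by (intro Min_le) auto
    have s_pos: "s > 0"
      using a less.prems(1)[of a] by (auto simp: A_def)
    define y where "y = x - s *\<^sub>R indicator_vec A"
    have x: "x = s *\<^sub>R indicator_vec A + y"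
      by (simp add: y_def)
    have x0: "x $ v = 0" if "v \<notin> A" for v
      using that by (simp add: A_def)
    have y0: "y $ v \<ge> 0" for v
      using s x0 by (auto simp: y_def)
    have "{v. y $ v \<noteq> 0} \<subset> A"
      using a x0 by (auto simp: y_def split: if_splits)
    then have "h * mass \<mu> y \<le> variation E w y"
      using less.prems(2) y0 unfolding A_def
      by (intro less.hyps psubset_card_mono) (auto simp: y_def A_def)
    moreover have "variation E w x = variation E w (s *\<^sub>R indicator_vec A) + variation E w y"
      unfolding x
    proof (rule variation_add[OF G])
      fix u v
      show "\<bar>(s *\<^sub>R indicator_vec A + y) $ u - (s *\<^sub>R indicator_vec A + y) $ v\<bar> =
        \<bar>(s *\<^sub>R indicator_vec A) $ u - (s *\<^sub>R indicator_vec A) $ v\<bar> + \<bar>y $ u - y $ v\<bar>"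
        using s_pos s[of u] s[of v] x0[of u] x0[of v] by (auto simp: y_def)
    qed
    moreover have "mass \<mu> x = s * sum \<mu> A + mass \<mu> y"
    proof -
      have "\<mu> v * \<bar>x $ v\<bar> = s * (\<mu> v * \<bar>indicator_vec A $ v\<bar>) + \<mu> v * \<bar>y $ v\<bar>" for v
        using s_pos s[of v] x0[of v] less.prems(1)[of v] by (auto simp: y_def algebra_simps)
      then show ?thesis
        by (simp add: mass_def sum.distrib flip: sum_distrib_left mass_indicator_vec[OF G])
    qed
    moreover have "s * (h * sum \<mu> A) \<le> variation E w (s *\<^sub>R indicator_vec A)"
    proof -
      have "h * sum \<mu> A \<le> cut_weight E w A"
        using False less.prems(2) by (intro cut) (auto simp: A_def)
      then show ?thesis
        using s_pos by (simp add: variation_scaleR[OF G] variation_indicator_vec[OF G])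
    qed
    ultimately show ?thesis
      by (simp add: distrib_left mult.left_commute[of h s])
  qed
qed

text \<open>
  Positive and negative part contribute separately to both mass and variation.
\<close>

lemma layer_cake:
  fixes E :: "'n::finite set set"
  assumes G: "weighted_graph E \<mu> w"
    and cut: "\<And>A. A \<noteq> {} \<Longrightarrow> A \<inter> Q = {} \<Longrightarrow> h * sum \<mu> A \<le> cut_weight E w A"
    and x: "\<And>v. v \<in> Q \<Longrightarrow> x $ v = 0"
  shows "h * mass \<mu> x \<le> variation E w x"
proof -
  define p q where "p = (\<chi> v. max (x $ v) 0)" and "q = (\<chi> v. max (- (x $ v)) 0)"
  have xpq: "x = p + (- 1) *\<^sub>R q"
    by (auto simp: p_def q_def vec_eq_iff)
  have "variation E w x = variation E w p + variation E w ((- 1) *\<^sub>R q)"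
    unfolding xpq by (rule variation_add[OF G]) (auto simp: p_def q_def max_def)
  also have "\<dots> = variation E w p + variation E w q"
    using variation_scaleR[OF G, of "- 1" q] by simp
  finally have "variation E w x = variation E w p + variation E w q" .
  moreover have "mass \<mu> x = mass \<mu> p + mass \<mu> q"
    unfolding mass_def sum.distrib[symmetric]
    by (intro sum.cong) (auto simp: p_def q_def max_def)
  moreover have "h * mass \<mu> p \<le> variation E w p" "h * mass \<mu> q \<le> variation E w q"
    using x by (auto intro!: layer_cake_nonneg[OF G cut, of Q] simp: p_def q_def)
  ultimately show ?thesis
    by (simp add: distrib_left)
qed

section \<open>Packing and piercing connected vertex sets\<close>

text \<open>
  Earlier neighbours with respect to a vertex order given by an injective ranking \<open>f\<close>. A graph in
  which every vertex has at most one earlier neighbour is a forest, the earlier neighbour being the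
  parent.
\<close>

definition earlier :: "'n set set \<Rightarrow> ('n \<Rightarrow> nat) \<Rightarrow> 'n \<Rightarrow> 'n set" where
  "earlier E f v = {u. {u, v} \<in> E \<and> f u < f v}"

text \<open>
  Each edge is counted exactly once, at its later endpoint.
\<close>

lemma sum_card_earlier:
  fixes E :: "'n::finite set set"
  assumes E: "E \<subseteq> {{u, v} | u v. u \<noteq> v}" and f: "inj f"
  shows "(\<Sum>v\<in>UNIV. card (earlier E f v)) = card E"
proof -
  let ?P = "SIGMA v:UNIV. earlier E f v"
  have "bij_betw (\<lambda>(v, u). {u, v}) ?P E"
    unfolding bij_betw_def
  proof
    show "inj_on (\<lambda>(v, u). {u, v}) ?P"
      by (auto simp: inj_on_def earlier_def doubleton_eq_iff)
    have "e \<in> (\<lambda>(v, u). {u, v}) ` ?P" if e: "e \<in> E" for e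
    proof -
      obtain u v where uv: "e = {u, v}" "u \<noteq> v"
        using e E by blast
      then have "f u < f v \<or> f v < f u"
        using f by (meson injD nat_neq_iff)
      then show ?thesis
      proof
        assume "f u < f v"
        then show ?thesis
          using uv e by (intro image_eqI[of _ _ "(v, u)"]) (auto simp: earlier_def)
      next
        assume "f v < f u"
        then show ?thesis
          using uv e by (intro image_eqI[of _ _ "(u, v)"]) (auto simp: earlier_def insert_commute)
      qed
    qed
    then show "(\<lambda>(v, u). {u, v}) ` ?P = E"
      by (auto simp: earlier_def)
  qed
  then have "card E = card ?P"
    by (simp add: bij_betw_same_card)
  then show ?thesis
    by (simp add: card_SigmaI)
qed

text \<open>
  Explore the graph greedily: continue with a neighbour of the explored set \<open>W\<close> as long as there
  is one. A vertex without earlier neighbours is then only chosen when \<open>W\<close> is a union of connected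
  components, so that vertices of this kind lie in different components.
\<close>

lemma exploration_partial:
  fixes E :: "'n::finite set set"
  assumes "m \<le> CARD('n)"
  shows "\<exists>W f. card W = m \<and> inj_on f W \<and> (\<forall>v\<in>W. f v < m) \<and>
     (\<forall>u\<in>W. \<forall>v\<in>W. earlier E f u \<inter> W = {} \<and> earlier E f v \<inter> W = {} \<and>
        (u, v) \<in> {(u, v). {u, v} \<in> E}\<^sup>* \<longrightarrow> u = v)"
  using assms
proof (induction m)
  case 0
  show ?case
    by (intro exI[of _ "{}"]) auto
next
  case (Suc m)
  let ?R = "{(u, v). {u, v} \<in> E}"
  have symR: "sym (?R\<^sup>*)"
    by (intro sym_rtrancl) (auto simp: sym_def insert_commute)
  obtain W f where W: "card W = m" and f: "inj_on f W" "\<And>v. v \<in> W \<Longrightarrow> f v < m"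
    and start: "\<And>u v. \<lbrakk>u \<in> W; v \<in> W; earlier E f u \<inter> W = {}; earlier E f v \<inter> W = {}; (u, v) \<in> ?R\<^sup>*\<rbrakk> \<Longrightarrow> u = v"
    using Suc by force
  have "W \<noteq> UNIV"
    using W Suc.prems by auto
  \<comment> \<open>any unexplored vertex will do once no edge leaves \<open>W\<close>\<close>
  then obtain z where z: "z \<notin> W" "(\<exists>y\<in>W. {y, z} \<in> E) \<or> \<not> (\<exists>x. x \<notin> W \<and> (\<exists>y\<in>W. {y, x} \<in> E))"
    by blast
  let ?f = "f(z := m)" and ?W = "insert z W"
  have old: "earlier E ?f u \<inter> ?W = earlier E f u \<inter> W" if "u \<in> W" for u
    using that z f(2)[of u] by (auto simp: earlier_def)
  \<comment> \<open>if \<open>z\<close> has no explored neighbour, then \<open>W\<close> is closed under adjacency\<close>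
  have new: "\<not> (u, z) \<in> ?R\<^sup>*" if u: "u \<in> W" and none: "earlier E ?f z \<inter> ?W = {}" for u
  proof
    assume "(u, z) \<in> ?R\<^sup>*"
    have "\<not> (\<exists>y\<in>W. {y, z} \<in> E)"
      using none z f(2) by (auto simp: earlier_def)
    then have closed: "x \<in> W" if "y \<in> W" "(y, x) \<in> ?R" for x y
      using z(2) that by auto
    have "z \<in> W"
      using \<open>(u, z) \<in> ?R\<^sup>*\<close> u by (induction rule: rtrancl_induct) (auto intro: closed)
    with z show False by simp
  qed
  show ?case
  proof (intro exI[of _ ?W] exI[of _ ?f] conjI)
    show "card ?W = Suc m"
      using W z by simp
    show "inj_on ?f ?W"
      using f z by (auto simp: inj_on_def)
    show "\<forall>v\<in>?W. ?f v < Suc m"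
      using f(2) by (auto simp: less_Suc_eq)
    show "\<forall>u\<in>?W. \<forall>v\<in>?W. earlier E ?f u \<inter> ?W = {} \<and> earlier E ?f v \<inter> ?W = {} \<and>
        (u, v) \<in> ?R\<^sup>* \<longrightarrow> u = v"
    proof (intro ballI impI, elim conjE)
      fix u v assume uv: "u \<in> ?W" "v \<in> ?W" "earlier E ?f u \<inter> ?W = {}" "earlier E ?f v \<inter> ?W = {}" "(u, v) \<in> ?R\<^sup>*"
      have vu: "(v, u) \<in> ?R\<^sup>*"
        using symR uv(5) by (rule symD)
      show "u = v"
      proof (cases "u \<in> W \<and> v \<in> W")
        case True
        then show ?thesis
          using start[OF _ _ _ _ uv(5)] uv(3,4) by (simp only: old)
      next
        case False
        then consider "u = v" | "u \<in> W" "v = z" | "v \<in> W" "u = z"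
          using uv(1,2) by blast
        then show ?thesis
          using new[of u] new[of v] uv(3,4,5) vu by cases blast+
      qed
    qed
  qed
qed

lemma exploration_order:
  fixes E :: "'n::finite set set"
  obtains f where "inj f" "card {v. earlier E f v = {}} \<le> card (graph_components E)"
proof -
  let ?R = "{(u, v). {u, v} \<in> E}"
  obtain W and f :: "'n \<Rightarrow> nat" where W: "card W = CARD('n)" and f: "inj_on f W"
    and start: "\<forall>u\<in>W. \<forall>v\<in>W. earlier E f u \<inter> W = {} \<and> earlier E f v \<inter> W = {} \<and> (u, v) \<in> ?R\<^sup>* \<longrightarrow> u = v"
    using exploration_partial[OF order_refl, of E] by blast
  have "W = UNIV"
    using W by (metis card_subset_eq finite subset_UNIV)
  have equiv: "equiv UNIV (?R\<^sup>*)"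
    by (intro equivI refl_rtrancl sym_rtrancl trans_rtrancl) (auto simp: sym_def insert_commute)
  have "inj_on (\<lambda>v. ?R\<^sup>* `` {v}) {v. earlier E f v = {}}"
    using start \<open>W = UNIV\<close> by (auto simp: inj_on_def eq_equiv_class_iff[OF equiv])
  then have "card {v. earlier E f v = {}} \<le> card (graph_components E)"
    by (intro card_inj_on_le) (auto simp: graph_components_def quotient_def)
  with f \<open>W = UNIV\<close> show thesis
    by (intro that[of f]) auto
qed

text \<open>
  With \<open>d v\<close> earlier neighbours at \<open>v\<close>, the indicator of \<open>d v \<ge> 2\<close> is at most \<open>d v - 1\<close> plus the
  indicator of \<open>d v = 0\<close>. Summation over all vertices gives \<open>card E - n\<close> plus the number of
  vertices that start a component.
\<close>

lemma card_many_earlier_le_cycle_rank: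
  fixes E :: "'n::finite set set"
  assumes E: "E \<subseteq> {{u, v} | u v. u \<noteq> v}" and f: "inj f"
    and start: "card {v. earlier E f v = {}} \<le> card (graph_components E)"
  shows "int (card {v. card (earlier E f v) \<ge> 2}) \<le> cycle_rank E"
proof -
  have "int (card {v. card (earlier E f v) \<ge> 2}) = (\<Sum>v\<in>UNIV. if card (earlier E f v) \<ge> 2 then 1 else 0)"
    by (simp add: sum.If_cases)
  also have "\<dots> \<le> (\<Sum>v\<in>UNIV. int (card (earlier E f v)) - 1 + (if earlier E f v = {} then 1 else 0))"
  proof (rule sum_mono)
    fix v
    have "card (earlier E f v) = 0 \<longleftrightarrow> earlier E f v = {}"
      by simp
    then show "(if card (earlier E f v) \<ge> 2 then 1 else 0) \<le> int (card (earlier E f v)) - 1 + (if earlier E f v = {} then 1 else 0)"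
      by (cases "card (earlier E f v)") auto
  qed
  also have "\<dots> = int (card E) - int CARD('n) + int (card {v. earlier E f v = {}})"
    by (simp add: sum.distrib sum_subtractf sum.If_cases flip: sum_card_earlier[OF E f])
  also have "\<dots> \<le> cycle_rank E"
    using start by (simp add: cycle_rank_def)
  finally show ?thesis .
qed

text \<open>
  In a forest, the earliest vertex of a connected set is its top: all others have their parent in the
  set.
  Otherwise the descendants of \<open>v\<close> inside \<open>C\<close> would be a proper part of \<open>C\<close> (all of them come after
  \<open>v\<close>, while \<open>u\<close> comes before) that no edge joins to the rest.
\<close>

lemma earlier_within_linked:
  fixes E :: "'n::finite set set"
  assumes f: "inj f" and C: "linked E C" and one: "\<And>v. v \<in> C \<Longrightarrow> card (earlier E f v) \<le> 1"
    and v: "v \<in> C" "u \<in> C" "f u < f v"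
  shows "earlier E f v \<inter> C \<noteq> {}"
proof
  assume none: "earlier E f v \<inter> C = {}"
  define r where "r = {(a, c). a \<in> C \<and> c \<in> C \<and> {a, c} \<in> E \<and> f a < f c}"
  \<comment> \<open>the descendants of \<open>v\<close> in \<open>C\<close>\<close>
  define D where "D = {z. (v, z) \<in> r\<^sup>*}"
  have D: "z \<in> C \<and> f v \<le> f z" if "z \<in> D" for z
    using that unfolding D_def mem_Collect_eq
    by (induction rule: rtrancl_induct) (use v in \<open>auto simp: r_def\<close>)
  have "D \<subseteq> C" "v \<in> D" "u \<notin> D"
    using D v by (force simp: D_def)+
  then obtain a c where ac: "a \<in> D" "c \<in> C" "c \<notin> D" "{a, c} \<in> E"
    using C v unfolding linked_def by (metis DiffD1 DiffD2 empty_iff)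
  have "a \<in> C"
    using D ac by auto
  have "\<not> f a < f c"
  proof
    assume "f a < f c"
    then have "(a, c) \<in> r"
      using ac \<open>a \<in> C\<close> by (simp add: r_def)
    then show False
      using ac by (auto simp: D_def intro: rtrancl_into_rtrancl)
  qed
  moreover have "a \<noteq> c"
    using ac by auto
  ultimately have "f c < f a"
    using f by (meson injD nat_neq_iff)
  then have c: "c \<in> earlier E f a"
    using ac by (simp add: earlier_def insert_commute)
  have "a \<noteq> v"
    using c none ac by auto
  then obtain a' where a': "(v, a') \<in> r\<^sup>*" "(a', a) \<in> r"
    using ac(1) unfolding D_def by (auto elim: rtranclE)
  then have "a' \<in> earlier E f a"
    by (simp add: r_def earlier_def)
  then have "a' = c"
    using c one[OF \<open>a \<in> C\<close>] by (metis One_nat_def card_le_Suc0_iff_eq finite)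
  then show False
    using a' ac by (simp add: D_def)
qed

text \<open>
  Take the first common vertex of the two sets. Were it different from the top \<open>t\<close> of \<open>C\<close>, it would
  come after the tops of both sets, since \<open>C'\<close> has a vertex no later than \<open>t\<close>; so its only parent
  would lie in both sets and be an earlier common vertex.
\<close>

lemma first_in_intersecting:
  fixes E :: "'n::finite set set"
  assumes f: "inj f" and C: "linked E C" "linked E C'" and one: "\<And>v. v \<in> C \<union> C' \<Longrightarrow> card (earlier E f v) \<le> 1"
    and meet: "C \<inter> C' \<noteq> {}" and t: "t \<in> C" "\<And>v. v \<in> C \<Longrightarrow> f t \<le> f v"
    and s: "s \<in> C'" "f s \<le> f t"
  shows "t \<in> C'"
proof -
  obtain z where z: "z \<in> C \<inter> C'" "\<And>y. y \<in> C \<inter> C' \<Longrightarrow> f z \<le> f y"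
    using meet ex_has_least_nat[of "\<lambda>z. z \<in> C \<inter> C'" _ f] by blast
  have "z = t"
  proof (rule ccontr)
    assume "z \<noteq> t"
    then have tz: "f t < f z"
      using t z f by (metis IntD1 injD le_neq_implies_less)
    obtain p where p: "p \<in> earlier E f z" "p \<in> C"
      using earlier_within_linked[OF f C(1) _ _ t(1) tz] one z(1) by blast
    have "f s < f z"
      using s tz by simp
    then obtain p' where p': "p' \<in> earlier E f z" "p' \<in> C'"
      using earlier_within_linked[OF f C(2) _ _ s(1), of z] one z(1) by blast
    have "card (earlier E f z) \<le> 1"
      using one z by blast
    then have "p = p'"
      using p p' by (metis One_nat_def card_le_Suc0_iff_eq finite)
    then have "f z \<le> f p"
      using p p' z by blast
    then show False
      using p by (simp add: earlier_def)
  qed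
  with z show ?thesis by auto
qed

text \<open>
  Duality between packing and piercing for subtrees of a forest. Choose the member \<open>C0\<close> whose top
  \<open>t\<close> comes last. Every member that meets \<open>C0\<close> contains \<open>t\<close>, by \<open>first_in_intersecting\<close>; so \<open>t\<close>
  pierces these, and \<open>C0\<close> is disjoint from all the others, to which induction applies.
\<close>

lemma packing_piercing:
  fixes E :: "'n::finite set set"
  assumes f: "inj f" and F: "\<And>C. C \<in> F \<Longrightarrow> linked E C"
     "\<And>C v. C \<in> F \<Longrightarrow> v \<in> C \<Longrightarrow> card (earlier E f v) \<le> 1"
  shows "\<exists>D Q. D \<subseteq> F \<and> disjoint D \<and> card Q \<le> card D \<and> (\<forall>C\<in>F. C \<inter> Q \<noteq> {})"
  using F
proof (induction "card F" arbitrary: F rule: less_induct)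
  case less
  show ?case
  proof (cases "F = {}")
    case True
    then show ?thesis
      by (intro exI[of _ "{}"]) auto
  next
    case False
    have ne: "C \<noteq> {}" if "C \<in> F" for C
      using less.prems(1)[OF that] by (simp add: linked_def)
    define m where "m C = Min (f ` C)" for C
    have "Max (m ` F) \<in> m ` F"
      using False by (intro Max_in) auto
    then obtain C0 where C0: "C0 \<in> F" "m C0 = Max (m ` F)"
      by auto
    have C0_max: "m C \<le> m C0" if "C \<in> F" for C
      unfolding C0(2) using that by (intro Max_ge) auto
    have m_in: "m C \<in> f ` C" if "C \<in> F" for C
      unfolding m_def using ne[OF that] by (intro Min_in) auto
    obtain t where t: "t \<in> C0" "f t = m C0"
      using m_in[OF C0(1)] by auto
    have t_min: "f t \<le> f v" if "v \<in> C0" for v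
      unfolding t(2) m_def using that by (intro Min_le) auto
    define F' where "F' = {C \<in> F. t \<notin> C}"
    have "F' \<subset> F"
      using C0 t by (auto simp: F'_def)
    then have "card F' < card F"
      by (intro psubset_card_mono) auto
    moreover have "linked E C" "v \<in> C \<Longrightarrow> card (earlier E f v) \<le> 1" if "C \<in> F'" for C v
      using less.prems that \<open>F' \<subset> F\<close> by blast+
    ultimately have "\<exists>D Q. D \<subseteq> F' \<and> disjoint D \<and> card Q \<le> card D \<and> (\<forall>C\<in>F'. C \<inter> Q \<noteq> {})"
      by (rule less.hyps)
    then obtain D Q where D: "D \<subseteq> F'" "disjoint D" "card Q \<le> card D" "\<And>C. C \<in> F' \<Longrightarrow> C \<inter> Q \<noteq> {}"
      by metis
    have dj: "C0 \<inter> C = {}" if C: "C \<in> F'" for C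
    proof (rule ccontr)
      assume meet: "C0 \<inter> C \<noteq> {}"
      have "C \<in> F"
        using C by (simp add: F'_def)
      then obtain s where s: "s \<in> C" "f s = m C"
        using m_in by (metis imageE)
      have "t \<in> C"
      proof (rule first_in_intersecting[OF f _ _ _ meet t(1) t_min s(1)])
        show "f s \<le> f t"
          using s t C0_max \<open>C \<in> F\<close> by simp
      qed (use less.prems C0 \<open>C \<in> F\<close> in auto)
      then show False
        using C by (simp add: F'_def)
    qed
    have "C0 \<notin> D"
      using D(1) t by (auto simp: F'_def)
    have "disjoint (insert C0 D)"
    proof -
      have "C0 \<inter> C = {}" "C \<inter> C0 = {}" if "C \<in> D" for C
        using dj[of C] D(1) that by blast+
      then show ?thesis
        using D(2) by (simp add: disjoint_def pairwise_insert disjnt_def)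
    qed
    moreover have "card (insert t Q) \<le> card (insert C0 D)"
      using D(3) \<open>C0 \<notin> D\<close> by (simp add: card_insert_if)
    moreover have "C \<inter> insert t Q \<noteq> {}" if "C \<in> F" for C
      using D(4)[of C] that by (auto simp: F'_def)
    moreover have "insert C0 D \<subseteq> F"
      using D(1) C0 by (auto simp: F'_def)
    ultimately show ?thesis
      by blast
  qed
qed

section \<open>The two inequalities\<close>

text \<open>
  The vectors \<open>\<Sum>t\<^sub>i 1\<^sub>A\<^sub>i\<close> whose coefficients \<open>t\<close> run over the unit sphere of \<open>\<real>\<^sup>k\<close>, realised as
  \<open>usphere (k - 1)\<close>. The sets are numbered from \<open>1\<close> and the basis vectors from \<open>0\<close>.
\<close>

lemma disjoint_combinations_genus:
  fixes A :: "nat \<Rightarrow> 'n::finite set"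
  assumes k: "k \<in> {1..CARD('n)}" and A: "A \<in> disjoint_tuples k"
  shows "\<exists>S\<in>genus_sets k. \<forall>x\<in>S. \<exists>t. x = (\<Sum>i\<in>{1..k}. t i *\<^sub>R indicator_vec (A i))"
proof -
  obtain b where "bij_betw b {..<DIM(real ^ 'n)} (Basis :: (real ^ 'n) set)"
    using ex_bij_betw_nat_finite[of "Basis :: (real ^ 'n) set"] by (auto simp only: atLeast0LessThan finite_Basis)
  then interpret basis_enumeration b
    by unfold_locales
  have d: "k - 1 < DIM(real ^ 'n)"
    using k by auto
  have dj: "disjoint_family_on A {1..k}" and ne: "\<And>i. i \<in> {1..k} \<Longrightarrow> A i \<noteq> {}"
    using A by (auto simp: disjoint_tuples_def PiE_def Pi_def)
  define \<phi> where "\<phi> y = (\<Sum>i\<in>{1..k}. (y \<bullet> b (i - 1)) *\<^sub>R indicator_vec (A i))" for y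
  define S where "S = \<phi> ` usphere (k - 1)"
  have \<phi>_cont: "continuous_on X \<phi>" for X
    unfolding \<phi>_def by (intro continuous_intros)
  have \<phi>_odd: "\<phi> (- y) = - \<phi> y" for y
    by (simp add: \<phi>_def sum_negf)
  have "\<phi> y \<noteq> 0" if y: "y \<in> usphere (k - 1)" for y
  proof -
    obtain i where i: "i \<le> k - 1" "y \<bullet> b i \<noteq> 0"
      using usphere_coordinate_nonzero[OF y] .
    then have "Suc i \<in> {1..k}"
      using k by auto
    moreover then obtain v where "v \<in> A (Suc i)"
      using ne by blast
    ultimately have "\<phi> y $ v = y \<bullet> b i"
      unfolding \<phi>_def using combination_nth[OF dj, of "Suc i" v "\<lambda>i. y \<bullet> b (i - 1)"] by simp
    then show ?thesis
      using i by auto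
  qed
  then have S0: "0 \<notin> S"
    by (auto simp: S_def)
  have "Suc (k - 1) \<le> genus S"
    using S0 by (intro genus_ge_of_odd_sphere_map[OF d \<phi>_cont]) (auto simp: odd_on_def \<phi>_odd S_def)
  moreover have "S \<noteq> {}"
  proof -
    have "b 0 \<in> usphere (k - 1)"
      using usphere_0 usphere_mono[of 0 "k - 1"] by auto
    then show ?thesis
      by (auto simp: S_def)
  qed
  moreover have "compact S"
    unfolding S_def by (rule compact_continuous_image[OF \<phi>_cont compact_usphere])
  moreover have "uminus ` S = S"
  proof -
    have "uminus ` usphere (k - 1) = usphere (k - 1)"
      using uminus_usphere by (metis (no_types, lifting) add.inverse_inverse image_eqI image_subsetI subsetI subset_antisym)
    moreover have "uminus ` S = \<phi> ` uminus ` usphere (k - 1)"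
      by (simp add: S_def image_image \<phi>_odd)
    ultimately show ?thesis
      by (simp add: S_def)
  qed
  ultimately have "S \<in> genus_sets k"
    using S0 k by (simp add: genus_sets_def)
  moreover have "\<exists>t. x = (\<Sum>i\<in>{1..k}. t i *\<^sub>R indicator_vec (A i))" if "x \<in> S" for x
    using that by (auto simp: S_def \<phi>_def)
  ultimately show ?thesis
    by blast
qed

text \<open>
  Otherwise the coordinates in \<open>Q\<close> would form an odd zero-free map into \<open>card Q < k\<close> dimensions.
\<close>

lemma genus_set_vanishing_coordinates:
  fixes S :: "(real ^ 'n::finite) set"
  assumes S: "S \<in> genus_sets k" and Q: "card Q < k"
  shows "\<exists>x\<in>S. \<forall>v\<in>Q. x $ v = 0"
proof (rule ccontr)
  assume no: "\<not> ?thesis"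
  obtain q where q: "bij_betw q {..<card Q} Q"
    using ex_bij_betw_nat_finite[of Q] by (auto simp: atLeast0LessThan)
  define f where "f x i = (if i < card Q then x $ q i else 0)" for x :: "real ^ 'n" and i
  have "continuous_on S f"
    unfolding f_def
  proof (rule continuous_on_coordinatewise_then_product)
    show "continuous_on S (\<lambda>x. if i < card Q then x $ q i else 0)" for i
      by (cases "i < card Q") (auto intro!: continuous_intros)
  qed
  moreover have "f x \<noteq> (\<lambda>i. 0)" if "x \<in> S" for x
  proof
    assume fx: "f x = (\<lambda>i. 0)"
    have "x $ v = 0" if v: "v \<in> Q" for v
    proof -
      obtain i where "i < card Q" "v = q i"
        using q v by (auto simp: bij_betw_def)
      then show ?thesis
        using fun_cong[OF fx, of i] by (simp add: f_def)
    qed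
    then show False
      using no \<open>x \<in> S\<close> by blast
  qed
  moreover have "f (- x) = (\<lambda>i. - f x i)" for x
    by (auto simp: f_def)
  ultimately have "odd_map_into S (card Q) f"
    by (auto simp: odd_map_into_def Euclidean_space_eq_top_of_set f_def[abs_def])
  moreover have "card Q \<ge> 1"
  proof -
    have "Q \<noteq> {}"
      using no S by (auto simp: genus_sets_def)
    then show ?thesis
      by (simp add: Suc_le_eq card_gt_0_iff)
  qed
  ultimately have "genus S \<le> card Q"
    unfolding genus_def by (intro Least_le) auto
  then show False
    using S Q by (simp add: genus_sets_def)
qed

text \<open>
  The vertices with at least two earlier neighbours destroy all cycles. The bad sets that avoid them
  live in a forest, and fewer than \<open>m\<close> of them are pairwise disjoint because \<open>m\<close> disjoint ones
  would be a competitor for the Cheeger constant with all expansions too small.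
\<close>

lemma piercing_set:
  fixes E :: "'n::finite set set"
  assumes G: "weighted_graph E \<mu> w" and m: "m \<ge> 1"
  obtains Q where "int (card Q) < int m + cycle_rank E"
    "\<And>C. linked E C \<Longrightarrow> cut_weight E w C < cheeger E \<mu> w m * sum \<mu> C \<Longrightarrow> C \<inter> Q \<noteq> {}"
proof -
  let ?h = "cheeger E \<mu> w m"
  have E: "E \<subseteq> {{u, v} | u v. u \<noteq> v}"
    using G by (simp add: weighted_graph_def)
  obtain f where f: "inj f" "card {v. earlier E f v = {}} \<le> card (graph_components E)"
    by (rule exploration_order)
  define Q0 where "Q0 = {v. card (earlier E f v) \<ge> 2}"
  define F where "F = {C. linked E C \<and> cut_weight E w C < ?h * sum \<mu> C \<and> C \<inter> Q0 = {}}"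
  have "card (earlier E f v) \<le> 1" if "C \<in> F" "v \<in> C" for C v
  proof -
    have "v \<notin> Q0"
      using that by (auto simp: F_def)
    then show ?thesis
      by (simp add: Q0_def)
  qed
  then obtain D Q1 where D: "D \<subseteq> F" "disjoint D" "card Q1 \<le> card D" "\<And>C. C \<in> F \<Longrightarrow> C \<inter> Q1 \<noteq> {}"
    using packing_piercing[OF f(1), of F E] by (auto simp: F_def)
  have "card D < m"
  proof (rule ccontr)
    assume "\<not> card D < m"
    then have "card {1..m} \<le> card D"
      by simp
    then obtain g where g: "g ` {1..m} \<subseteq> D" "inj_on g {1..m}"
      using card_le_inj[of "{1..m}" D] by auto
    let ?A = "restrict g {1..m}"
    have "g i \<noteq> {}" if "i \<in> {1..m}" for i
    proof -
      have "g i \<in> F"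
        using g(1) D(1) that by blast
      then show ?thesis
        by (simp add: F_def linked_def)
    qed
    moreover have "disjoint_family_on ?A {1..m}"
      unfolding disjoint_family_on_def
    proof (intro ballI impI)
      fix i j assume ij: "i \<in> {1..m}" "j \<in> {1..m}" "i \<noteq> j"
      then have "g i \<in> D" "g j \<in> D" "g i \<noteq> g j"
        using g by (auto simp: inj_on_eq_iff)
      then show "?A i \<inter> ?A j = {}"
        using D(2) ij by (simp add: disjointD)
    qed
    ultimately have "?A \<in> disjoint_tuples m"
      by (auto simp: disjoint_tuples_def)
    then obtain i where i: "i \<in> {1..m}" "?h \<le> expansion E \<mu> w (g i)"
      using cheeger_le_some_expansion[of ?A m E \<mu> w] m by auto
    have "g i \<in> F"
      using i(1) g(1) D(1) by blast
    then have "cut_weight E w (g i) < ?h * sum \<mu> (g i)" "sum \<mu> (g i) > 0"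
      by (auto simp: F_def linked_def intro: volume_pos[OF G])
    with i(2) show False
      by (simp add: expansion_eq le_divide_eq)
  qed
  show thesis
  proof (rule that)
    have "card (Q0 \<union> Q1) \<le> card Q0 + card D"
      using card_Un_le[of Q0 Q1] D(3) by simp
    moreover have "int (card Q0) \<le> cycle_rank E"
      unfolding Q0_def by (rule card_many_earlier_le_cycle_rank[OF E f])
    ultimately show "int (card (Q0 \<union> Q1)) < int m + cycle_rank E"
      using \<open>card D < m\<close> by linarith
    show "C \<inter> (Q0 \<union> Q1) \<noteq> {}" if "linked E C" "cut_weight E w C < ?h * sum \<mu> C" for C
      using that D(4)[of C] by (auto simp: F_def)
  qed
qed

text \<open>
  The witness is a vector of \<open>S\<close> that vanishes on the piercing set \<open>Q\<close>: a set of too small expansion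
  contains a connected one and hence meets \<open>Q\<close>, so the layers of the vector all expand enough.
\<close>

lemma cheeger_le_sup_rayleigh:
  fixes E :: "'n::finite set set"
  assumes G: "weighted_graph E \<mu> w" and S: "S \<in> genus_sets k" and m: "int k - cycle_rank E \<ge> 1"
  shows "cheeger E \<mu> w (nat (int k - cycle_rank E)) \<le> (SUP x\<in>S. rayleigh E \<mu> w x)"
proof -
  let ?m = "nat (int k - cycle_rank E)"
  let ?h = "cheeger E \<mu> w ?m"
  have "?m \<ge> 1"
    using m by linarith
  then obtain Q where Q: "int (card Q) < int ?m + cycle_rank E"
    "\<And>C. linked E C \<Longrightarrow> cut_weight E w C < ?h * sum \<mu> C \<Longrightarrow> C \<inter> Q \<noteq> {}"
    using piercing_set[OF G] by metis
  have "card Q < k"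
    using Q(1) m by linarith
  then obtain x where x: "x \<in> S" "\<And>v. v \<in> Q \<Longrightarrow> x $ v = 0"
    using genus_set_vanishing_coordinates[OF S] by blast
  have "?h * sum \<mu> A \<le> cut_weight E w A" if "A \<noteq> {}" "A \<inter> Q = {}" for A
  proof (rule ccontr)
    assume "\<not> ?thesis"
    then obtain C where "C \<subseteq> A" "linked E C" "cut_weight E w C < ?h * sum \<mu> C"
      using linked_subset_low_expansion[OF G \<open>A \<noteq> {}\<close>] by (metis not_le)
    then show False
      using Q(2) that by blast
  qed
  then have "?h * mass \<mu> x \<le> variation E w x"
    by (rule layer_cake[OF G]) (use x in auto)
  moreover have "mass \<mu> x > 0"
    using S x by (intro mass_pos[OF G]) (auto simp: genus_sets_def)
  ultimately have "?h \<le> rayleigh E \<mu> w x"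
    by (simp add: rayleigh_eq le_divide_eq)
  also have "\<dots> \<le> (SUP x\<in>S. rayleigh E \<mu> w x)"
    using rayleigh_max_attained[OF G S] x(1) by metis
  finally show ?thesis .
qed

theorem theorem6:
  fixes E :: "'n::finite set set" and \<mu> :: "'n \<Rightarrow> real" and w :: "'n set \<Rightarrow> real" and k :: nat
  assumes "weighted_graph E \<mu> w"
    and "k \<in> {1..CARD('n)}"
  shows "minmax_eigenvalue E \<mu> w k \<le> cheeger E \<mu> w k \<and>
    (int k - cycle_rank E \<ge> 1 \<longrightarrow>
       cheeger E \<mu> w (nat (int k - cycle_rank E)) \<le> minmax_eigenvalue E \<mu> w k)"
proof (intro conjI impI)
  note G = assms(1)
  obtain A where A: "A \<in> disjoint_tuples k"
    "\<And>i. i \<in> {1..k} \<Longrightarrow> expansion E \<mu> w (A i) \<le> cheeger E \<mu> w k"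
    using cheeger_attained[OF assms(2)] by blast
  obtain S where S: "S \<in> genus_sets k" "\<And>x. x \<in> S \<Longrightarrow> \<exists>t. x = (\<Sum>i\<in>{1..k}. t i *\<^sub>R indicator_vec (A i))"
    using disjoint_combinations_genus[OF assms(2) A(1)] by blast
  have "rayleigh E \<mu> w x \<le> cheeger E \<mu> w k" if x: "x \<in> S" for x
  proof -
    obtain t where t: "x = (\<Sum>i\<in>{1..k}. t i *\<^sub>R indicator_vec (A i))"
      using S(2) x by blast
    show ?thesis
      unfolding t
    proof (rule rayleigh_combination_le[OF G])
      show "(\<Sum>i\<in>{1..k}. t i *\<^sub>R indicator_vec (A i)) \<noteq> 0"
        using S(1) x t by (auto simp: genus_sets_def)
    qed (use A in \<open>auto simp: disjoint_tuples_def\<close>)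
  qed
  then have "(SUP x\<in>S. rayleigh E \<mu> w x) \<le> cheeger E \<mu> w k"
    using S(1) by (intro cSUP_least) (auto simp: genus_sets_def)
  moreover have "minmax_eigenvalue E \<mu> w k \<le> (SUP x\<in>S. rayleigh E \<mu> w x)"
    unfolding minmax_eigenvalue_def
  proof (rule cINF_lower[OF _ S(1)])
    show "bdd_below ((\<lambda>S. SUP x\<in>S. rayleigh E \<mu> w x) ` genus_sets k)"
    proof (rule bdd_belowI2[of _ 0])
      fix T :: "(real ^ 'n) set" assume T: "T \<in> genus_sets k"
      then obtain x where x: "x \<in> T" "rayleigh E \<mu> w x = (SUP x\<in>T. rayleigh E \<mu> w x)"
        using rayleigh_max_attained[OF G T] by blast
      moreover have "rayleigh E \<mu> w x \<ge> 0"
      proof -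
        have "x \<noteq> 0"
          using x(1) T by (auto simp: genus_sets_def)
        then show ?thesis
          using variation_nonneg[OF G] mass_pos[OF G] by (simp add: rayleigh_eq less_imp_le)
      qed
      ultimately show "0 \<le> (SUP x\<in>T. rayleigh E \<mu> w x)"
        using x(2) by simp
    qed
  qed
  ultimately show "minmax_eigenvalue E \<mu> w k \<le> cheeger E \<mu> w k"
    by simp
  show "cheeger E \<mu> w (nat (int k - cycle_rank E)) \<le> minmax_eigenvalue E \<mu> w k"
    if "int k - cycle_rank E \<ge> 1"
    unfolding minmax_eigenvalue_def
  proof (rule cINF_greatest)
    show "genus_sets k \<noteq> ({} :: (real ^ 'n) set set)"
      using S(1) by blast
  qed (rule cheeger_le_sup_rayleigh[OF G _ that])
qed

end
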